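(* Let $r \ge 2$. If $\alpha \in A_r$ does not act as the identity on $O_r$, then the transformation $\beta \in \mathrm{GAC}_r(F_r)$ derived from $\alpha$ does not act as the identity on $F_r^r$. Moreover, $\beta$ does not act as the identity on $\mathrm{NGen}_r(F_r)$. It follows that $A_{r,r}$ is isomorphic to $\mathrm{GAC}_r(F_r)$ and to $\mathrm{AC}(F_r)$; therefore $\mathrm{GAC}_r(F_r) \simeq \mathrm{AC}(F_r)$.
   Context: For group elements write $g^h = hgh^{-1}$. Groups $\mathrm{GAC}$ and $\mathrm{AC}$. For a group $G$, the elementary AC-moves on $G^r$ are the bijections changing only the $i$-th component ($1\le i\le r$): $R_{ij}^{\pm1}$ ($i\ne j$): $u_i \mapsto u_iu_j^{\pm1}$; $L_{ij}^{\pm1}$ ($i \ne j$): $u_i \mapsto u_j^{\pm1}u_i$; $I_i$: $u_i\mapsto u_i^{-1}$; $C_{i,w}$ ($w\in G$): $u_i \mapsto u_i^w$. $\mathrm{GAC}_r(G)$ is the subgroup of $\mathrm{Sym}(G^r)$ generated by all elementary AC-moves. $\mathrm{NGen}_r(G)\subseteq G^r$ is the set of $r$-tuples whose normal closure is $G$; it is invariant under the AC-moves, and $\mathrm{AC}_r(G)$ is the subgroup of $\mathrm{Sym}(\mathrm{NGen}_r(G))$ generated by the restrictions of the AC-moves. $F_r$ is a free group of rank $r$ and $\mathrm{AC}(F_r) = \mathrm{AC}_r(F_r)$. Groups $A_{r,r}$ and $A_r$. Let $F_{r,r}$ be a free group of rank $2r$ with free basis $\{f_1,\ldots,f_r\}\cup\{y_1,\ldots,y_r\}$,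 and identify $F_r$ with the subgroup $\langle f_1,\ldots,f_r\rangle$. $A_{r,r}$ is the group of bijections of the set of tuples $(u_1,\ldots,u_r,y_1,\ldots,y_r)$, $u_i\in F_{r,r}$ (equivalently, of $F_{r,r}^r$), generated by: $\mathrm{AC}_1(i,j)$ ($i\neq j$), replacing $u_i$ by $u_iu_j$; $\mathrm{AC}_2(i,j)$ ($i\ne j$), replacing $u_i$ by $u_ju_i$; $\mathrm{AC}_3(i)$, replacing $u_i$ by $u_i^{-1}$; $\mathrm{AC}_4(i,k)$, replacing $u_i$ by $u_i^{y_k}$ (here $1\le i,j,k\le r$). $O_r \subseteq F_{r,r}^r$ is the union of the $A_{r,r}$-orbits of all tuples $u=(u_1,\ldots,u_r)\in F_r^r$. $A_r$ is the group of transformations of $O_r$ obtained by restricting $A_{r,r}$ to $O_r$. The derived transformation $\beta$. Let $x=(x_1,\ldots,x_r)$ be a basis of $F_r$. Given $\alpha\in A_r$, expressed as a product of transformations $\mathrm{AC}_1,\mathrm{AC}_2,\mathrm{AC}_3,\mathrm{AC}_4$ and their inverses, $\beta$ is the transformation of $F_r^r$ obtained by replacing in every factor of the form $\mathrm{AC}_4(i,k)^{\pm1}$ the conjugator $y_k$ by $x_k$. The assignment $\nu:\alpha\mapsto\beta$ is a well-defined homomorphism $A_r\to\mathrm{GAC}_r(F_r)$. *)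

theory Defs
  imports "HOL-Algebra.Algebra"
begin

section \<open>Free bases\<close>

text \<open>A letter \<open>(i, True)\<close> stands for \<open>b i\<close> and \<open>(i, False)\<close> for its inverse.\<close>

definition word_val :: "('a, 'b) monoid_scheme \<Rightarrow> ('i \<Rightarrow> 'a) \<Rightarrow> ('i \<times> bool) list \<Rightarrow> 'a" where
  "word_val G b w =
     foldr (\<lambda>(i, e) g. (if e then b i else inv\<^bsub>G\<^esub> (b i)) \<otimes>\<^bsub>G\<^esub> g) w \<one>\<^bsub>G\<^esub>"

definition reduced :: "('i \<times> bool) list \<Rightarrow> bool" where
  "reduced = successively (\<lambda>(i, e) (j, d). \<not> (i = j \<and> e \<noteq> d))"

text \<open>The family \<open>b\<close>, indexed by \<open>I\<close>, generates \<open>G\<close> and satisfies no nontrivial relation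
  (this forces \<open>b\<close> to be injective on \<open>I\<close>).\<close>

definition free_basis :: "('a, 'b) monoid_scheme \<Rightarrow> 'i set \<Rightarrow> ('i \<Rightarrow> 'a) \<Rightarrow> bool" where
  "free_basis G I b \<longleftrightarrow>
     b \<in> I \<rightarrow> carrier G \<and>
     generate G (b ` I) = carrier G \<and>
     (\<forall>w \<in> lists (I \<times> UNIV). reduced w \<and> w \<noteq> [] \<longrightarrow> word_val G b w \<noteq> \<one>\<^bsub>G\<^esub>)"


section \<open>Tuples and the groups \<open>GAC\<close> and \<open>AC\<close>\<close>

definition conj_by :: "('a, 'b) monoid_scheme \<Rightarrow> 'a \<Rightarrow> 'a \<Rightarrow> 'a" where
  "conj_by G g h = h \<otimes>\<^bsub>G\<^esub> g \<otimes>\<^bsub>G\<^esub> inv\<^bsub>G\<^esub> h"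

definition tuples :: "nat \<Rightarrow> ('a, 'b) monoid_scheme \<Rightarrow> (nat \<Rightarrow> 'a) set" where
  "tuples r G = {1..r} \<rightarrow>\<^sub>E carrier G"

text \<open>The self-map of \<open>tuples r G\<close> that changes only the \<open>i\<close>-th component, to \<open>c u\<close>.
  It is restricted to \<open>tuples r G\<close> because elements of \<^const>\<open>BijGroup\<close> are extensional.\<close>

definition change :: "nat \<Rightarrow> ('a, 'b) monoid_scheme \<Rightarrow> nat \<Rightarrow> ((nat \<Rightarrow> 'a) \<Rightarrow> 'a)
    \<Rightarrow> (nat \<Rightarrow> 'a) \<Rightarrow> (nat \<Rightarrow> 'a)" where
  "change r G i c = (\<lambda>u \<in> tuples r G. u(i := c u))"

definition AC_moves :: "nat \<Rightarrow> ('a, 'b) monoid_scheme \<Rightarrow> ((nat \<Rightarrow> 'a) \<Rightarrow> (nat \<Rightarrow> 'a)) set" where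
  "AC_moves r G =
     {change r G i (\<lambda>u. u i \<otimes>\<^bsub>G\<^esub> u j) | i j. i \<in> {1..r} \<and> j \<in> {1..r} \<and> i \<noteq> j} \<union>
     {change r G i (\<lambda>u. u i \<otimes>\<^bsub>G\<^esub> inv\<^bsub>G\<^esub> (u j)) | i j. i \<in> {1..r} \<and> j \<in> {1..r} \<and> i \<noteq> j} \<union>
     {change r G i (\<lambda>u. u j \<otimes>\<^bsub>G\<^esub> u i) | i j. i \<in> {1..r} \<and> j \<in> {1..r} \<and> i \<noteq> j} \<union>
     {change r G i (\<lambda>u. inv\<^bsub>G\<^esub> (u j) \<otimes>\<^bsub>G\<^esub> u i) | i j. i \<in> {1..r} \<and> j \<in> {1..r} \<and> i \<noteq> j} \<union>
     {change r G i (\<lambda>u. inv\<^bsub>G\<^esub> (u i)) | i. i \<in> {1..r}} \<union>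
     {change r G i (\<lambda>u. conj_by G (u i) w) | i w. i \<in> {1..r} \<and> w \<in> carrier G}"

definition GAC :: "nat \<Rightarrow> ('a, 'b) monoid_scheme \<Rightarrow> ((nat \<Rightarrow> 'a) \<Rightarrow> (nat \<Rightarrow> 'a)) monoid" where
  "GAC r G = subgroup_generated (BijGroup (tuples r G)) (AC_moves r G)"

definition normal_closure :: "('a, 'b) monoid_scheme \<Rightarrow> 'a set \<Rightarrow> 'a set" where
  "normal_closure G S = \<Inter> {N. N \<lhd> G \<and> S \<subseteq> N}"

definition NGen :: "nat \<Rightarrow> ('a, 'b) monoid_scheme \<Rightarrow> (nat \<Rightarrow> 'a) set" where
  "NGen r G = {u \<in> tuples r G. normal_closure G (u ` {1..r}) = carrier G}"

definition AC :: "nat \<Rightarrow> ('a, 'b) monoid_scheme \<Rightarrow> ((nat \<Rightarrow> 'a) \<Rightarrow> (nat \<Rightarrow> 'a)) monoid" where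
  "AC r G = subgroup_generated (BijGroup (NGen r G)) ((\<lambda>m. restrict m (NGen r G)) ` AC_moves r G)"


section \<open>The groups \<open>A\<^sub>r\<^sub>,\<^sub>r\<close> and \<open>A\<^sub>r\<close>\<close>

text \<open>The transformations are given by symbols, so that a product of them can be evaluated
  both with the conjugators \<open>y\<^sub>k\<close> and with the conjugators \<open>x\<^sub>k\<close>.\<close>

datatype ac_symbol = AC1 nat nat | AC2 nat nat | AC3 nat | AC4 nat nat

definition ac_symbols :: "nat \<Rightarrow> ac_symbol set" where
  "ac_symbols r =
     {AC1 i j | i j. i \<in> {1..r} \<and> j \<in> {1..r} \<and> i \<noteq> j} \<union>
     {AC2 i j | i j. i \<in> {1..r} \<and> j \<in> {1..r} \<and> i \<noteq> j} \<union>
     {AC3 i | i. i \<in> {1..r}} \<union>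
     {AC4 i k | i k. i \<in> {1..r} \<and> k \<in> {1..r}}"

fun ac_map :: "nat \<Rightarrow> ('a, 'b) monoid_scheme \<Rightarrow> (nat \<Rightarrow> 'a) \<Rightarrow> ac_symbol
    \<Rightarrow> (nat \<Rightarrow> 'a) \<Rightarrow> (nat \<Rightarrow> 'a)" where
  "ac_map r G z (AC1 i j) = change r G i (\<lambda>u. u i \<otimes>\<^bsub>G\<^esub> u j)"
| "ac_map r G z (AC2 i j) = change r G i (\<lambda>u. u j \<otimes>\<^bsub>G\<^esub> u i)"
| "ac_map r G z (AC3 i) = change r G i (\<lambda>u. inv\<^bsub>G\<^esub> (u i))"
| "ac_map r G z (AC4 i k) = change r G i (\<lambda>u. conj_by G (u i) (z k))"

text \<open>Below, \<open>G\<close> is the free group \<open>F\<^sub>r\<^sub>,\<^sub>r\<close> with basis \<open>f\<^sub>1, \<dots>, f\<^sub>r, y\<^sub>1, \<dots>, y\<^sub>r\<close>.\<close>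

definition A_rr :: "nat \<Rightarrow> ('a, 'b) monoid_scheme \<Rightarrow> (nat \<Rightarrow> 'a)
    \<Rightarrow> ((nat \<Rightarrow> 'a) \<Rightarrow> (nat \<Rightarrow> 'a)) monoid" where
  "A_rr r G y = subgroup_generated (BijGroup (tuples r G)) (ac_map r G y ` ac_symbols r)"

definition F_sub :: "nat \<Rightarrow> ('a, 'b) monoid_scheme \<Rightarrow> (nat \<Rightarrow> 'a) \<Rightarrow> ('a, 'b) monoid_scheme" where
  "F_sub r G f = subgroup_generated G (f ` {1..r})"

definition O_set :: "nat \<Rightarrow> ('a, 'b) monoid_scheme \<Rightarrow> (nat \<Rightarrow> 'a) \<Rightarrow> (nat \<Rightarrow> 'a)
    \<Rightarrow> (nat \<Rightarrow> 'a) set" where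
  "O_set r G f y = (\<Union>u \<in> tuples r (F_sub r G f). {\<alpha> u | \<alpha>. \<alpha> \<in> carrier (A_rr r G y)})"

definition A_r :: "nat \<Rightarrow> ('a, 'b) monoid_scheme \<Rightarrow> (nat \<Rightarrow> 'a) \<Rightarrow> (nat \<Rightarrow> 'a)
    \<Rightarrow> ((nat \<Rightarrow> 'a) \<Rightarrow> (nat \<Rightarrow> 'a)) monoid" where
  "A_r r G f y = (BijGroup (O_set r G f y))
     \<lparr>carrier := (\<lambda>\<alpha>. restrict \<alpha> (O_set r G f y)) ` carrier (A_rr r G y)\<rparr>"


section \<open>The derived transformation\<close>

text \<open>A product of the transformations \<open>AC\<^sub>1, \<dots>, AC\<^sub>4\<close> and their inverses, with conjugators
  \<open>z\<close>; the sign \<open>False\<close> marks an inverse.\<close>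

definition ac_prod :: "nat \<Rightarrow> ('a, 'b) monoid_scheme \<Rightarrow> (nat \<Rightarrow> 'a) \<Rightarrow> (ac_symbol \<times> bool) list
    \<Rightarrow> (nat \<Rightarrow> 'a) \<Rightarrow> (nat \<Rightarrow> 'a)" where
  "ac_prod r G z w = word_val (BijGroup (tuples r G)) (ac_map r G z) w"

text \<open>\<open>\<beta>\<close> is derived from \<open>\<alpha>\<close>: some expression of \<open>\<alpha>\<close> as such a product (acting on \<open>O\<^sub>r\<close>)
  turns into \<open>\<beta>\<close>, acting on tuples over \<open>F\<^sub>r\<close>, when every \<open>y\<^sub>k\<close> is replaced by \<open>x\<^sub>k\<close>.
  This is the graph of \<open>\<nu>\<close>.\<close>

definition derived_from :: "nat \<Rightarrow> ('a, 'b) monoid_scheme \<Rightarrow> (nat \<Rightarrow> 'a) \<Rightarrow> (nat \<Rightarrow> 'a) \<Rightarrow> (nat \<Rightarrow> 'a)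
    \<Rightarrow> ((nat \<Rightarrow> 'a) \<Rightarrow> (nat \<Rightarrow> 'a)) \<Rightarrow> ((nat \<Rightarrow> 'a) \<Rightarrow> (nat \<Rightarrow> 'a)) \<Rightarrow> bool" where
  "derived_from r G f y x \<alpha> \<beta> \<longleftrightarrow>
     (\<exists>w \<in> lists (ac_symbols r \<times> UNIV).
        \<alpha> = restrict (ac_prod r G y w) (O_set r G f y) \<and>
        \<beta> = ac_prod r (F_sub r G f) x w)"

end

theory Submission
  imports Defs "HOL-Library.Sublist"
begin

text \<open>
  A product \<open>w\<close> of the generating transformations acts on tuples by a substitution
  \<open>u\<^sub>i \<mapsto> W\<^sub>i(u, z)\<close>, where the words \<open>W\<^sub>i\<close> in \<open>u\<^sub>1, \<dots>, u\<^sub>r, z\<^sub>1, \<dots>, z\<^sub>r\<close> depend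
  neither on the group nor on the conjugators \<open>z\<close>. If every \<open>W\<^sub>i\<close> freely reduces to \<open>u\<^sub>i\<close>, then
  \<open>w\<close> acts trivially everywhere. Otherwise it moves the tuple \<open>(f\<^sub>1, \<dots>, f\<^sub>r)\<close>, since
  \<open>f\<^sub>1, \<dots>, y\<^sub>r\<close> is a free basis, and it also moves some tuple in \<open>NGen\<close>: if the reduced form
  \<open>V(u, x)\<close> of \<open>W\<^sub>i u\<^sub>i\<^sup>-\<^sup>1\<close> is nonempty and of length less than \<open>N\<close>, put
  \<open>u\<^sub>j = g\<^sub>j x\<^sub>j g\<^sub>j\<^sup>-\<^sup>1\<close> with \<open>g\<^sub>j = x\<^sub>1\<^sup>N\<^sup>j x\<^sub>2\<close> (or \<open>x\<^sub>1\<^sup>2\<^sup>N x\<^sub>2 x\<^sub>1\<close> if \<open>j = 2\<close>). These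
  conjugates of a basis normally generate, and a ping-pong argument shows \<open>V(u, x) \<noteq> 1\<close>, because a
  word of length less than \<open>N\<close> cannot carry one \<open>g\<^sub>i\<close> onto another. Hence \<open>A\<^sub>r\<^sub>,\<^sub>r\<close>,
  \<open>GAC\<close> and \<open>AC\<close> are generated by families satisfying the same relations.
\<close>

section \<open>Free reduction\<close>

definition flip :: "'i \<times> bool \<Rightarrow> 'i \<times> bool" where
  "flip a = (fst a, \<not> snd a)"

definition inv_word :: "('i \<times> bool) list \<Rightarrow> ('i \<times> bool) list" where
  "inv_word w = rev (map flip w)"

text \<open>Left multiplication by a letter on reduced words; \<open>foldr push w []\<close> is the reduced form
  of \<open>w\<close>.\<close>

definition push :: "'i \<times> bool \<Rightarrow> ('i \<times> bool) list \<Rightarrow> ('i \<times> bool) list" where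
  "push a s = (if s \<noteq> [] \<and> hd s = flip a then tl s else a # s)"

lemma flip_simps [simp]: "flip (i, e) = (i, \<not> e)" "flip (flip a) = a" "fst (flip a) = fst a"
  by (simp_all add: flip_def)

lemma flip_neq [simp]: "flip a \<noteq> a" "a \<noteq> flip a"
  by (auto simp: flip_def prod_eq_iff)

lemma inv_word_simps [simp]:
  "inv_word [] = []" "inv_word (a # w) = inv_word w @ [flip a]"
  "inv_word (v @ w) = inv_word w @ inv_word v" "length (inv_word w) = length w"
  "inv_word w = [] \<longleftrightarrow> w = []"
  by (simp_all add: inv_word_def)

lemma inv_word_replicate: "inv_word (replicate n a) = replicate n (flip a)"
  by (simp add: inv_word_def)

lemma inv_word_lists: "w \<in> lists (I \<times> UNIV) \<Longrightarrow> inv_word w \<in> lists (I \<times> UNIV)"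
  by (induction w) (auto simp: flip_def)

lemma hd_inv_word: "w \<noteq> [] \<Longrightarrow> hd (inv_word w) = flip (last w)"
  by (simp add: inv_word_def hd_rev last_map)

lemma last_inv_word: "w \<noteq> [] \<Longrightarrow> last (inv_word w) = flip (hd w)"
  by (simp add: inv_word_def last_rev hd_map)

lemma reduced_Nil [simp]: "reduced []"
  by (simp add: reduced_def)

lemma reduced_rel_eq: "(\<lambda>(i, e) (j, d). \<not> (i = j \<and> e \<noteq> d)) = (\<lambda>a c. c \<noteq> flip a)"
  by (auto simp: fun_eq_iff flip_def)

lemma reduced_append:
  "reduced (v @ w) \<longleftrightarrow> reduced v \<and> reduced w \<and> (v = [] \<or> w = [] \<or> hd w \<noteq> flip (last v))"
  unfolding reduced_def reduced_rel_eq by (auto simp: successively_append_iff)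

lemma reduced_Cons: "reduced (a # w) \<longleftrightarrow> reduced w \<and> (w = [] \<or> hd w \<noteq> flip a)"
  unfolding reduced_def reduced_rel_eq by (cases w) auto

lemma reduced_inv_word: "reduced (inv_word w) = reduced w"
proof (induction w)
  case (Cons a w)
  then show ?case
    by (auto simp: reduced_append reduced_Cons last_inv_word)
qed simp

section \<open>Letters acting on reduced words by left multiplication\<close>

lemma reduced_push: "reduced s \<Longrightarrow> reduced (push a s)"
  by (cases s) (auto simp: push_def reduced_Cons)

lemma reduced_foldr_push: "reduced s \<Longrightarrow> reduced (foldr push v s)"
  by (induction v) (auto simp: reduced_push)

lemma push_lists: "a \<in> A \<Longrightarrow> s \<in> lists A \<Longrightarrow> push a s \<in> lists A"
  by (cases s) (auto simp: push_def)

lemma foldr_push_lists: "v \<in> lists A \<Longrightarrow> s \<in> lists A \<Longrightarrow> foldr push v s \<in> lists A"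
  by (induction v) (simp_all add: push_lists)

lemma foldr_push_reduced: "reduced (v @ s) \<Longrightarrow> foldr push v s = v @ s"
  by (induction v) (auto simp: reduced_Cons push_def)

lemma push_flip_Cons [simp]: "push (flip a) (a # s) = s"
  by (simp add: push_def)

lemma foldr_push_cancel: "foldr push (inv_word v) (v @ s) = s"
  by (induction v arbitrary: s) simp_all

text \<open>Letters of \<open>s\<close> cancel only as long as \<open>s\<close> agrees with
  \<open>g\<close>. As \<open>g\<close> is not exhausted, the letter \<open>flip (last g)\<close>,
  multiplied last, survives in front.\<close>

lemma foldr_push_not_prefix:
  assumes "reduced s" "reduced g" "\<not> prefix g s"
  shows "\<exists>t. foldr push (inv_word g) s = flip (last g) # t"
  using assms
proof (induction g arbitrary: s)
  case (Cons a g)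
  show ?case
  proof (cases "s \<noteq> [] \<and> hd s = a")
    case True
    then obtain s' where s: "s = a # s'"
      by (cases s) auto
    with Cons.prems have "g \<noteq> []" "reduced s'" "reduced g" "\<not> prefix g s'"
      by (auto simp: reduced_Cons)
    with Cons.IH show ?thesis
      by (simp add: s)
  next
    case False
    then have push: "push (flip a) s = flip a # s"
      by (auto simp: push_def)
    have "reduced (inv_word (a # g) @ s)"
      using Cons.prems False
      by (auto simp: reduced_append reduced_inv_word reduced_Cons last_inv_word)
    then have eq: "foldr push (inv_word (a # g)) s = inv_word (a # g) @ s"
      by (rule foldr_push_reduced)
    have "inv_word (a # g) \<noteq> []" "hd (inv_word (a # g)) = flip (last (a # g))"
      by (simp, rule hd_inv_word, simp)
    with eq show ?thesis
      by (metis append_Cons list.collapse)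
  qed
qed simp

text \<open>Cancellation happens only where the factors meet: a tail \<open>inv_word p\<close> of
  \<open>c\<close> against a head \<open>p\<close> of \<open>s\<close>.\<close>

lemma foldr_push_decomp:
  assumes "reduced c"
  shows "\<exists>c' p s'. c = c' @ inv_word p \<and> s = p @ s' \<and> foldr push c s = c' @ s'"
  using assms
proof (induction c)
  case (Cons a c)
  then obtain c' p s' where
    c: "c = c' @ inv_word p" "s = p @ s'" "foldr push c s = c' @ s'"
    by (auto simp: reduced_Cons)
  \<comment> \<open>Either a surviving part \<open>c'\<close> shields \<open>s'\<close> from
    \<open>a\<close>, because \<open>a # c\<close> is reduced, or \<open>c\<close> is used up and
    \<open>a\<close> does or does not cancel the next letter of \<open>s'\<close>.\<close>
  consider "c' \<noteq> []" | "c' = []" "s' \<noteq> []" "hd s' = flip a"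
    | "c' = []" "\<not> (s' \<noteq> [] \<and> hd s' = flip a)"
    by blast
  then show ?case
  proof cases
    case 1
    with Cons.prems c have "push a (c' @ s') = (a # c') @ s'"
      by (auto simp: push_def reduced_Cons)
    with c have "a # c = (a # c') @ inv_word p \<and> s = p @ s' \<and>
        foldr push (a # c) s = (a # c') @ s'"
      by simp
    then show ?thesis
      by blast
  next
    case 2
    then obtain s'' where "s' = flip a # s''"
      by (cases s') auto
    then have "a # c = [] @ inv_word (p @ [flip a]) \<and> s = (p @ [flip a]) @ s'' \<and>
        foldr push (a # c) s = [] @ s''"
      using 2 c push_flip_Cons[of "flip a" s''] by simp
    then show ?thesis
      by blast
  next
    case 3
    then have "push a s' = a # s'"
      by (auto simp: push_def)
    with 3 c have "a # c = [a] @ inv_word p \<and> s = p @ s' \<and> foldr push (a # c) s = [a] @ s'"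
      by simp
    then show ?thesis
      by blast
  qed
qed simp

section \<open>Ping-pong\<close>

lemma replicate_append_Cons_eq:
  assumes "replicate m a @ b # v = replicate n a @ b # w" "a \<noteq> b"
  shows "m = n"
proof -
  have "takeWhile ((=) a) (replicate k a @ b # u) = replicate k a" for k u
    using assms(2) by (induction k) auto
  from this[of m v] this[of n w] assms(1) show ?thesis
    by (metis length_replicate)
qed

lemma prefix_append_replicate:
  assumes "p @ s = replicate n a @ t" "length p \<le> n"
  shows "p = replicate (length p) a" "s = replicate (n - length p) a @ t"
proof -
  have "p = take (length p) (replicate n a @ t)" "s = drop (length p) (replicate n a @ t)"
    by (simp_all flip: assms(1))
  with assms(2) show "p = replicate (length p) a" "s = replicate (n - length p) a @ t"
    by (simp_all add: min_def)
qed

text \<open>Fewer than \<open>N\<close> letters cannot use up either block of letters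
  \<open>a\<close>. They change its length by less than \<open>N\<close>, while the lengths
  \<open>N * i\<close> and \<open>N * j\<close> differ by a multiple of \<open>N\<close>.\<close>

lemma no_short_overlap:
  assumes c: "reduced c" "length c < N" and ij: "i \<ge> 1" "j \<ge> 1" and "a \<noteq> b"
    and eq: "foldr push c (replicate (N * i) a @ b # s) = replicate (N * j) a @ b # t"
  shows "c = [] \<and> i = j"
proof -
  obtain c' p s' where d: "c = c' @ inv_word p" "replicate (N * i) a @ b # s = p @ s'"
    "foldr push c (replicate (N * i) a @ b # s) = c' @ s'"
    using foldr_push_decomp[OF c(1)] by blast
  have len: "length c' + length p < N"
    using c(2) d(1) by simp
  have le: "N \<le> N * i" "N \<le> N * j"
    using ij by simp_all
  have "length p \<le> N * i"
    using len le by linarith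
  note p = prefix_append_replicate[OF d(2)[symmetric] this]
  have "length c' \<le> N * j"
    using len le by linarith
  note c' = prefix_append_replicate[OF trans[OF d(3)[symmetric] eq] this]
  \<comment> \<open>Both sides equal \<open>s'\<close>; the initial runs of \<open>a\<close>, each
    ended by \<open>b\<close>, must have the same length.\<close>
  have "replicate (N * i - length p) a @ b # s = replicate (N * j - length c') a @ b # t"
    using p(2) c'(2) by simp
  from replicate_append_Cons_eq[OF this \<open>a \<noteq> b\<close>]
  have bal: "N * i + length c' = N * j + length p"
    using len le by linarith
  have "i = j"
  proof (rule ccontr)
    assume "i \<noteq> j"
    then consider "i + 1 \<le> j" | "j + 1 \<le> i"
      by linarith
    then show False
    proof cases
      case 1
      from mult_le_mono2[OF this, of N] bal len show False by (simp add: algebra_simps)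
    next
      case 2
      from mult_le_mono2[OF this, of N] bal len show False by (simp add: algebra_simps)
    qed
  qed
  with bal have m: "length c' = length p"
    by simp
  \<comment> \<open>Both \<open>c'\<close> and \<open>p\<close> are powers of \<open>a\<close> of
    equal length, so \<open>c\<close> is a power of \<open>a\<close> followed by its inverse, which
    is reduced only if empty.\<close>
  have "c = replicate (length p) a @ replicate (length p) (flip a)"
    using d(1) p(1) c'(1) m by (metis inv_word_replicate)
  with c(1) have "length p = 0"
    by (cases "length p = 0") (auto simp: reduced_append)
  with m d(1) \<open>i = j\<close> show ?thesis
    by simp
qed

text \<open>The exponent \<open>N * i\<close> makes the conjugators differ by long shifts; the extra letter for
  \<open>i = 2\<close> ensures that \<open>conjugator N i\<close> does not end in the letter \<open>i\<close>.\<close>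

definition conjugator :: "nat \<Rightarrow> nat \<Rightarrow> (nat \<times> bool) list" where
  "conjugator N i =
     replicate (N * i) (1, True) @ (2, True) # (if i = 2 then [(1, True)] else [])"

text \<open>The sign sits on the middle letter only, since inverting a conjugate just inverts the
  conjugated element.\<close>

fun subst_letter :: "nat \<Rightarrow> (nat + nat) \<times> bool \<Rightarrow> (nat \<times> bool) list" where
  "subst_letter N (Inl i, e) = conjugator N i @ (i, e) # inv_word (conjugator N i)"
| "subst_letter N (Inr k, e) = [(k, e)]"

section \<open>Conjugates of basis letters as ping-pong players\<close>

lemma reduced_replicate: "reduced (replicate n a)"
  by (induction n) (auto simp: reduced_Cons)

lemma reduced_conjugator: "reduced (conjugator N i)"
  by (auto simp: conjugator_def reduced_append reduced_Cons reduced_replicate)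

lemma conjugator_neq_Nil [simp]: "conjugator N i \<noteq> []"
  by (simp add: conjugator_def)

lemma fst_last_conjugator: "fst (last (conjugator N i)) \<noteq> i"
  by (simp add: conjugator_def)

text \<open>Separation of the players: every conjugator starts with a power of the first letter
  ended by the second, so \<open>no_short_overlap\<close> applies.\<close>

lemma conjugator_no_prefix:
  assumes "reduced c" "length c < N" "i \<ge> 1" "j \<ge> 1"
    "prefix (conjugator N j) (foldr push c (conjugator N i @ s))"
  shows "c = [] \<and> i = j"
proof -
  obtain t where
    "foldr push c (conjugator N i @ s) = replicate (N * j) (1, True) @ (2, True) # t"
    using assms(5) by (auto simp: prefix_def conjugator_def)
  then show ?thesis
    using no_short_overlap[OF assms(1-4), of "(1, True)" "(2, True)"]
    by (auto simp: conjugator_def)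
qed

text \<open>By \<open>foldr_push_not_prefix\<close> a letter of the inverse conjugator survives in
  front, and its index is not \<open>j\<close>. The middle letter and then the conjugator are
  therefore prepended without cancellation.\<close>

lemma foldr_push_conjugate:
  assumes "reduced s" "\<not> prefix (conjugator N j) s"
  shows "\<exists>t. foldr push (subst_letter N (Inl j, d)) s = conjugator N j @ (j, d) # t
    \<and> reduced (conjugator N j @ (j, d) # t)"
proof -
  let ?g = "conjugator N j"
  obtain t where t: "foldr push (inv_word ?g) s = flip (last ?g) # t"
    using foldr_push_not_prefix[OF assms(1) reduced_conjugator assms(2)] by blast
  have "reduced (flip (last ?g) # t)"
    using reduced_foldr_push[OF assms(1)] t by metis
  then have red: "reduced (?g @ (j, d) # flip (last ?g) # t)"
    using fst_last_conjugator[of N j]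
    by (auto simp: reduced_append reduced_conjugator reduced_Cons[of "(j, d)"] flip_def)
  then have "push (j, d) (flip (last ?g) # t) = (j, d) # flip (last ?g) # t"
    by (auto simp: reduced_append reduced_Cons push_def)
  with t foldr_push_reduced[OF red] red show ?thesis
    by auto
qed

abbreviation subst_word :: "nat \<Rightarrow> ((nat + nat) \<times> bool) list \<Rightarrow> (nat \<times> bool) list" where
  "subst_word N V \<equiv> concat (map (subst_letter N) V)"

text \<open>Ping-pong invariant: once a conjugated letter \<open>Inl i\<close> has been read (from the right), the
  current reduced word starts with \<open>conjugator N i\<close>, up to the short prefix \<open>c\<close> read since.\<close>

lemma subst_word_invariant:
  assumes "reduced V" "length V < N" "\<forall>i e. (Inl i, e) \<in> set V \<longrightarrow> i \<ge> 1"
  shows "(\<exists>c. V = map (apfst Inr) c \<and> foldr push (subst_word N V) [] = c) \<or>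
    (\<exists>c i e V' t. V = map (apfst Inr) c @ (Inl i, e) # V' \<and>
       reduced (conjugator N i @ (i, e) # t) \<and>
       foldr push (subst_word N V) [] = foldr push c (conjugator N i @ (i, e) # t))"
  using assms
proof (induction V)
  case (Cons a V)
  let ?S = "\<lambda>V. foldr push (subst_word N V) []"
  have map_red: "reduced (map (apfst Inr) c :: ((nat + nat) \<times> bool) list) = reduced c"
    for c :: "(nat \<times> bool) list"
    by (induction c) (auto simp: reduced_Cons neq_Nil_conv apfst_def map_prod_def flip_def)
  have S_Cons: "?S (a # V) = foldr push (subst_letter N a) (?S V)"
    by simp
  have "reduced V" "length V < N" "\<forall>i e. (Inl i, e) \<in> set V \<longrightarrow> i \<ge> 1"
    using Cons.prems by (auto simp: reduced_Cons)
  note IH = Cons.IH[OF this]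
  have redS: "reduced (?S V)"
    by (simp add: reduced_foldr_push)
  show ?case
  proof (cases a)
    case a: (Pair l d)
    show ?thesis
    proof (cases l)
      \<comment> \<open>A letter \<open>Inr k\<close> merely extends \<open>c\<close>. In the first
        alternative nothing cancels because \<open>a # V\<close> is reduced.\<close>
      case (Inr k)
      with IH show ?thesis
      proof (elim disjE exE conjE)
        fix c assume c: "V = map (apfst Inr) c" "?S V = c"
        have "reduced ((k, d) # c)"
          using Cons.prems(1) map_red[of "(k, d) # c"] c(1) a Inr by simp
        then have "push (k, d) c = (k, d) # c"
          using foldr_push_reduced[of "[(k, d)]" c] by simp
        then have "?S (a # V) = (k, d) # c"
          using S_Cons c(2) a Inr by simp
        with c(1) a Inr show ?thesis
          by (intro disjI1 exI[of _ "(k, d) # c"]) simp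
      next
        fix c i e V' t
        assume "V = map (apfst Inr) c @ (Inl i, e) # V'"
          "reduced (conjugator N i @ (i, e) # t)"
          "?S V = foldr push c (conjugator N i @ (i, e) # t)"
        with a Inr S_Cons show ?thesis
          by (intro disjI2 exI[of _ "(k, d) # c"] exI[of _ i] exI[of _ e] exI[of _ V'] exI[of _ t])
            simp
      qed
    next
      case (Inl j)
      have j: "j \<ge> 1"
        using Cons.prems(3) a Inl by auto
      \<comment> \<open>If the conjugator of \<open>j\<close> is not in front, it is created there,
        and the short prefix restarts with \<open>c = []\<close>.\<close>
      have fresh: ?thesis if np: "\<not> prefix (conjugator N j) (?S V)"
      proof -
        obtain t where t: "?S (a # V) = conjugator N j @ (j, d) # t"
          "reduced (conjugator N j @ (j, d) # t)"
          using foldr_push_conjugate[OF redS np, of d] S_Cons a Inl by auto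
        then show ?thesis
          by (intro disjI2 exI[of _ "[]"] exI[of _ j] exI[of _ d] exI[of _ V] exI[of _ t])
            (simp add: a Inl)
      qed
      from IH show ?thesis
      proof (elim disjE exE conjE)
        fix c assume c: "V = map (apfst Inr) c" "?S V = c"
        \<comment> \<open>With no conjugated letter read so far, the current word is too short to
          contain the conjugator.\<close>
        have "length c < N"
          using c(1) Cons.prems(2) by simp
        moreover have "N \<le> N * j"
          using j by simp
        moreover have "N * j < length (conjugator N j)"
          unfolding conjugator_def by simp
        ultimately have "length c < length (conjugator N j)"
          by linarith
        with c(2) show ?thesis
          by (intro fresh) (auto dest: prefix_length_le)
      next
        fix c i e V' t
        assume V: "V = map (apfst Inr) c @ (Inl i, e) # V'"
          "reduced (conjugator N i @ (i, e) # t)"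
          "?S V = foldr push c (conjugator N i @ (i, e) # t)"
        show ?thesis
        \<comment> \<open>The only way for the conjugator of \<open>j\<close> to be in front already
          is that the preceding letter has index \<open>j\<close> too. Reducedness then forces equal
          signs, the inner conjugators cancel, and the power of the middle letter grows.\<close>
        proof (cases "c = [] \<and> i = j")
          case True
          then have "e = d"
            using Cons.prems(1) V(1) a Inl by (simp add: reduced_Cons)
          have "?S V = conjugator N j @ (j, d) # t"
            using V(3) True \<open>e = d\<close> by simp
          then have "foldr push (inv_word (conjugator N j)) (?S V) = (j, d) # t"
            by (simp add: foldr_push_cancel)
          moreover have "push (j, d) ((j, d) # t) = (j, d) # (j, d) # t"
            by (simp add: push_def)
          moreover have red: "reduced (conjugator N j @ (j, d) # (j, d) # t)"
            using V(2) True \<open>e = d\<close> by (simp add: reduced_append reduced_Cons[of _ "_ # _"])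
          ultimately have "?S (a # V) = conjugator N j @ (j, d) # (j, d) # t"
            using S_Cons a Inl foldr_push_reduced[OF red] by simp
          with red show ?thesis
            by (intro disjI2 exI[of _ "[]"] exI[of _ j] exI[of _ d] exI[of _ V]
                exI[of _ "(j, d) # t"]) (simp add: a Inl)
        next
          case False
          have "reduced c" "length c < N" "i \<ge> 1"
            using \<open>reduced V\<close> Cons.prems(2,3) V(1) map_red[of c] by (auto simp: reduced_append)
          with False j V(3) show ?thesis
            using conjugator_no_prefix[of c N i j "(i, e) # t"] by (intro fresh) metis
        qed
      qed
    qed
  qed
qed simp

text \<open>The fewer than \<open>N\<close> letters of \<open>c\<close> remove at most one letter
  each from a conjugator longer than \<open>N\<close>. Without conjugated letters, the result is
  \<open>V\<close> itself up to relabelling.\<close>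

lemma subst_word_nontrivial:
  assumes "reduced V" "V \<noteq> []" "length V < N" "\<forall>i e. (Inl i, e) \<in> set V \<longrightarrow> i \<ge> 1"
  shows "foldr push (subst_word N V) [] \<noteq> []"
  using subst_word_invariant[OF assms(1,3,4)]
proof (elim disjE exE conjE)
  fix c i e V' t
  assume V: "V = map (apfst Inr) c @ (Inl i, e) # V'"
    and eq: "foldr push (subst_word N V) [] = foldr push c (conjugator N i @ (i, e) # t)"
  have "i \<ge> 1"
    using assms(4) V by auto
  then have "N \<le> N * i"
    by simp
  show ?thesis
  proof
    assume "foldr push (subst_word N V) [] = []"
    moreover have "length s \<le> length c + length (foldr push c s)" for s
    proof (induction c)
      case (Cons a c)
      have "length u \<le> Suc (length (push a u))" for u
        by (simp add: push_def)
      from this[of "foldr push c s"] Cons show ?case by simp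
    qed simp
    from this[of "conjugator N i @ (i, e) # t"]
    have "length (conjugator N i) \<le> length c + length (foldr push (subst_word N V) [])"
      unfolding eq by simp
    moreover have "N * i \<le> length (conjugator N i)"
      unfolding conjugator_def by simp
    ultimately have "N * i \<le> length c"
      by simp
    with \<open>N \<le> N * i\<close> have "N \<le> length c"
      by (rule order_trans)
    then show False
      using assms(3) V by simp
  qed
qed (use assms(2) in auto)

section \<open>Values of words in groups\<close>

declare One_nat_def [simp del]

context group
begin

abbreviation letter_val :: "('i \<Rightarrow> 'a) \<Rightarrow> 'i \<times> bool \<Rightarrow> 'a" where
  "letter_val b a \<equiv> (if snd a then b (fst a) else inv (b (fst a)))"

lemma word_val_Nil [simp]: "word_val G b [] = \<one>"
  by (simp add: word_val_def)

lemma word_val_Cons: "word_val G b (a # w) = letter_val b a \<otimes> word_val G b w"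
  by (simp add: word_val_def split: prod.split)

lemma word_val_closed [simp]:
  "b \<in> I \<rightarrow> carrier G \<Longrightarrow> w \<in> lists (I \<times> UNIV) \<Longrightarrow> word_val G b w \<in> carrier G"
  by (induction w) (auto simp: word_val_Cons Pi_iff)

lemma word_val_single:
  "b i \<in> carrier G \<Longrightarrow> word_val G b [(i, e)] = (if e then b i else inv (b i))"
  by (simp add: word_val_Cons)

lemma word_val_append:
  assumes b: "b \<in> I \<rightarrow> carrier G" and "v \<in> lists (I \<times> UNIV)" "w \<in> lists (I \<times> UNIV)"
  shows "word_val G b (v @ w) = word_val G b v \<otimes> word_val G b w"
  using assms(2)
proof (induction v)
  case (Cons a v)
  then have "letter_val b a \<in> carrier G" "word_val G b v \<in> carrier G"
    using b by (auto simp: Pi_iff)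
  then show ?case
    using Cons assms(3) b by (simp add: word_val_Cons m_assoc)
qed (use assms in simp)

lemma word_val_inv_word:
  assumes b: "b \<in> I \<rightarrow> carrier G" and "w \<in> lists (I \<times> UNIV)"
  shows "word_val G b (inv_word w) = inv (word_val G b w)"
  using assms(2)
proof (induction w)
  case (Cons a w)
  then have a: "letter_val b a \<in> carrier G" "b (fst a) \<in> carrier G"
    and w: "word_val G b w \<in> carrier G" "w \<in> lists (I \<times> UNIV)" "inv_word w \<in> lists (I \<times> UNIV)"
    and fa: "[flip a] \<in> lists (I \<times> UNIV)"
    using b by (auto simp: Pi_iff inv_word_lists flip_def)
  have "word_val G b (inv_word (a # w)) = inv (word_val G b w) \<otimes> word_val G b [flip a]"
    using word_val_append[OF b w(3) fa] Cons by simp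
  also have "word_val G b [flip a] = inv (letter_val b a)"
    using a by (simp add: word_val_Cons flip_def)
  also have "inv (word_val G b w) \<otimes> inv (letter_val b a) = inv (word_val G b (a # w))"
    using a(1) w(1) by (simp only: word_val_Cons inv_mult_group)
  finally show ?case .
qed simp

lemma word_val_push:
  assumes b: "b \<in> I \<rightarrow> carrier G" and "a \<in> I \<times> UNIV" "s \<in> lists (I \<times> UNIV)"
  shows "word_val G b (push a s) = letter_val b a \<otimes> word_val G b s"
proof (cases "s \<noteq> [] \<and> hd s = flip a")
  case True
  then obtain s' where s: "s = flip a # s'"
    by (cases s) auto
  have "word_val G b s' \<in> carrier G" "b (fst a) \<in> carrier G"
    using assms s b by (auto simp: Pi_iff)
  then show ?thesis
    by (simp add: s push_def word_val_Cons flip_def flip: m_assoc)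
qed (auto simp: push_def word_val_Cons)

lemma word_val_foldr_push:
  assumes b: "b \<in> I \<rightarrow> carrier G" and "w \<in> lists (I \<times> UNIV)"
  shows "word_val G b (foldr push w []) = word_val G b w"
  using assms(2)
proof (induction w)
  case (Cons a w)
  then show ?case
    using word_val_push[OF b, of a "foldr push w []"]
    by (simp add: word_val_Cons foldr_push_lists)
qed simp

section \<open>Generated subgroups and free bases in terms of words\<close>

lemma generate_word_val:
  assumes b: "b \<in> I \<rightarrow> carrier G"
  shows "generate G (b ` I) = word_val G b ` lists (I \<times> UNIV)"
proof (intro equalityI subsetI)
  fix g assume "g \<in> generate G (b ` I)"
  then show "g \<in> word_val G b ` lists (I \<times> UNIV)"
  proof induction
    case one
    show ?case by (rule image_eqI[of _ _ "[]"]) simp_all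
  next
    case (incl h)
    then obtain i where "i \<in> I" "h = b i" by auto
    with b show ?case
      by (intro image_eqI[of _ _ "[(i, True)]"]) (auto simp: word_val_single Pi_iff)
  next
    case (inv h)
    then obtain i where "i \<in> I" "h = b i" by auto
    with b show ?case
      by (intro image_eqI[of _ _ "[(i, False)]"]) (auto simp: word_val_single Pi_iff)
  next
    case (eng h1 h2)
    then obtain v w where "v \<in> lists (I \<times> UNIV)" "h1 = word_val G b v"
      "w \<in> lists (I \<times> UNIV)" "h2 = word_val G b w"
      by auto
    with b show ?case
      by (intro image_eqI[of _ _ "v @ w"]) (simp_all add: word_val_append[OF b])
  qed
next
  fix g assume "g \<in> word_val G b ` lists (I \<times> UNIV)"
  then obtain w where g: "g = word_val G b w" and "w \<in> lists (I \<times> UNIV)" by auto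
  from this(2) show "g \<in> generate G (b ` I)" unfolding g
    by (induction w) (auto simp: word_val_Cons intro!: generate.eng intro: generate.intros)
qed

lemma carrier_subgroup_generated_family:
  assumes "b \<in> I \<rightarrow> carrier G"
  shows "carrier (subgroup_generated G (b ` I)) = word_val G b ` lists (I \<times> UNIV)"
proof -
  have "carrier G \<inter> b ` I = b ` I"
    using assms by auto
  then show ?thesis
    using generate_word_val[OF assms] by (simp add: carrier_subgroup_generated)
qed

lemma word_val_eq_iff:
  assumes b: "b \<in> I \<rightarrow> carrier G" and vw: "v \<in> lists (I \<times> UNIV)" "w \<in> lists (I \<times> UNIV)"
  shows "word_val G b v = word_val G b w \<longleftrightarrow> word_val G b (v @ inv_word w) = \<one>"
  using word_val_append[OF b vw(1) inv_word_lists[OF vw(2)]] word_val_inv_word[OF b vw(2)]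
    word_val_closed[OF b vw(1)] word_val_closed[OF b vw(2)]
  by (metis inv_closed inv_inv inv_equality r_inv)

text \<open>A nonempty reduced form of \<open>v @ inv_word w\<close> would be a nontrivial relation,
  which a free basis excludes.\<close>

lemma free_basis_word_val_eq:
  assumes "free_basis G I b" "v \<in> lists (I \<times> UNIV)" "w \<in> lists (I \<times> UNIV)"
    and "word_val G b v = word_val G b w"
  shows "foldr push (v @ inv_word w) [] = []"
proof (rule ccontr)
  have b: "b \<in> I \<rightarrow> carrier G"
    using assms(1) by (simp add: free_basis_def)
  let ?V = "v @ inv_word w"
  have V: "?V \<in> lists (I \<times> UNIV)"
    using assms(2,3) inv_word_lists by auto
  assume "foldr push ?V [] \<noteq> []"
  moreover have "reduced (foldr push ?V [])" "foldr push ?V [] \<in> lists (I \<times> UNIV)"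
    using V by (simp_all only: reduced_foldr_push reduced_Nil foldr_push_lists lists.Nil)
  ultimately have "word_val G b (foldr push ?V []) \<noteq> \<one>"
    using assms(1) unfolding free_basis_def by blast
  then show False
    using word_val_foldr_push[OF b V] word_val_eq_iff[OF b assms(2,3)] assms(4) by simp
qed

text \<open>Converse of \<open>free_basis_word_val_eq\<close>, valid in every group because free
  reduction preserves values.\<close>

lemma word_val_eqI:
  assumes b: "b \<in> I \<rightarrow> carrier G" and vw: "v \<in> lists (I \<times> UNIV)" "w \<in> lists (I \<times> UNIV)"
    and "foldr push (v @ inv_word w) [] = []"
  shows "word_val G b v = word_val G b w"
proof -
  have "v @ inv_word w \<in> lists (I \<times> UNIV)"
    using vw inv_word_lists by auto
  from word_val_foldr_push[OF b this] show ?thesis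
    unfolding word_val_eq_iff[OF b vw] assms(4) by simp
qed

end

section \<open>Isomorphism of groups generated by families with the same relations\<close>

text \<open>The isomorphism sends the value of a word in \<open>H\<close> to the value of the same
  word in \<open>K\<close>. Equality of two values is the relation \<open>v @ inv_word w\<close>, so
  this is both well defined and injective.\<close>

lemma iso_subgroup_generated:
  assumes "group H" "group K"
    and b: "b \<in> I \<rightarrow> carrier H" and c: "c \<in> I \<rightarrow> carrier K"
    and rel: "\<And>w. w \<in> lists (I \<times> UNIV) \<Longrightarrow> word_val H b w = \<one>\<^bsub>H\<^esub> \<longleftrightarrow> word_val K c w = \<one>\<^bsub>K\<^esub>"
  shows "subgroup_generated H (b ` I) \<cong> subgroup_generated K (c ` I)"
proof -
  interpret H: group H by fact
  interpret K: group K by fact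
  let ?L = "lists (I \<times> (UNIV :: bool set))"
  note carr = H.carrier_subgroup_generated_family[OF b] K.carrier_subgroup_generated_family[OF c]
  have eq_iff: "word_val H b v = word_val H b w \<longleftrightarrow> word_val K c v = word_val K c w"
    if "v \<in> ?L" "w \<in> ?L" for v w
  proof -
    have "v @ inv_word w \<in> ?L"
      using that inv_word_lists by auto
    from rel[OF this] show ?thesis
      using H.word_val_eq_iff[OF b that] K.word_val_eq_iff[OF c that] by simp
  qed
  \<comment> \<open>An arbitrary representing word is chosen; \<open>eq_iff\<close> makes the result
    independent of the choice.\<close>
  define \<phi> where "\<phi> g = word_val K c (SOME w. w \<in> ?L \<and> word_val H b w = g)" for g
  have \<phi>: "\<phi> (word_val H b w) = word_val K c w" if "w \<in> ?L" for w
  proof -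
    let ?v = "SOME v. v \<in> ?L \<and> word_val H b v = word_val H b w"
    have "?v \<in> ?L \<and> word_val H b ?v = word_val H b w"
      by (rule someI[of _ w]) (use that in simp)
    then show ?thesis
      unfolding \<phi>_def using eq_iff that by blast
  qed
  have "\<phi> \<in> iso (subgroup_generated H (b ` I)) (subgroup_generated K (c ` I))"
  proof (rule isoI)
    show "\<phi> \<in> hom (subgroup_generated H (b ` I)) (subgroup_generated K (c ` I))"
    proof (rule homI)
      fix g h
      assume "g \<in> carrier (subgroup_generated H (b ` I))"
        "h \<in> carrier (subgroup_generated H (b ` I))"
      then obtain v w where vw: "v \<in> ?L" "w \<in> ?L" "g = word_val H b v" "h = word_val H b w"
        unfolding carr by blast
      then have "v @ w \<in> ?L"
        by simp
      from \<phi>[OF this] show "\<phi> (g \<otimes>\<^bsub>subgroup_generated H (b ` I)\<^esub> h) =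
          \<phi> g \<otimes>\<^bsub>subgroup_generated K (c ` I)\<^esub> \<phi> h"
        using vw \<phi> by (simp add: H.word_val_append[OF b] K.word_val_append[OF c])
    qed (unfold carr, use \<phi> in \<open>auto simp del: in_lists_conv_set\<close>)
    have "inj_on \<phi> (word_val H b ` ?L)"
      by (rule inj_onI, elim imageE) (metis eq_iff \<phi>)
    moreover have "\<phi> ` word_val H b ` ?L = word_val K c ` ?L"
      unfolding image_image using \<phi> by (intro image_cong) auto
    ultimately show "bij_betw \<phi> (carrier (subgroup_generated H (b ` I)))
        (carrier (subgroup_generated K (c ` I)))"
      by (simp add: carr bij_betw_def)
  qed
  then show ?thesis
    by (auto simp: is_iso_def)
qed

section \<open>Products of moves as substitutions\<close>

lemma BijGroup_simps [simp]:
  "carrier (BijGroup S) = Bij S" "\<one>\<^bsub>BijGroup S\<^esub> = (\<lambda>x \<in> S. x)"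
  "g \<in> Bij S \<Longrightarrow> h \<in> Bij S \<Longrightarrow> g \<otimes>\<^bsub>BijGroup S\<^esub> h = compose S g h"
  by (simp_all add: BijGroup_def)

lemma Bij_and_inverseI:
  assumes "g \<in> extensional S" "h \<in> extensional S"
    and gh: "\<And>x. x \<in> S \<Longrightarrow> g x \<in> S" "\<And>x. x \<in> S \<Longrightarrow> h x \<in> S"
      "\<And>x. x \<in> S \<Longrightarrow> g (h x) = x" "\<And>x. x \<in> S \<Longrightarrow> h (g x) = x"
  shows "g \<in> Bij S" "inv\<^bsub>BijGroup S\<^esub> g = h"
proof -
  have "bij_betw g S S" "bij_betw h S S"
    using gh by (auto intro!: bij_betwI[of g S S h] bij_betwI[of h S S g])
  then have *: "g \<in> Bij S" "h \<in> Bij S"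
    using assms(1,2) by (simp_all add: Bij_def)
  then show "g \<in> Bij S" by simp
  have "compose S h g = (\<lambda>x \<in> S. x)"
    using gh(4) by (auto simp: compose_def fun_eq_iff)
  then show "inv\<^bsub>BijGroup S\<^esub> g = h"
    using * by (intro group.inv_equality[OF group_BijGroup]) simp_all
qed

lemma eq_one_BijGroup_iff:
  assumes "g \<in> Bij S"
  shows "g = \<one>\<^bsub>BijGroup S\<^esub> \<longleftrightarrow> (\<forall>u \<in> S. g u = u)"
  using Bij_imp_extensional[OF assms] by (auto simp: fun_eq_iff extensional_def)

lemma tuples_upd: "u \<in> tuples r G \<Longrightarrow> i \<in> {1..r} \<Longrightarrow> v \<in> carrier G \<Longrightarrow> u(i := v) \<in> tuples r G"
  by (auto simp: tuples_def PiE_iff extensional_def)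

lemma tuples_comp [simp]: "u \<in> tuples r G \<Longrightarrow> i \<in> {1..r} \<Longrightarrow> u i \<in> carrier G"
  by (auto simp: tuples_def)

lemma change_Bij:
  assumes "i \<in> {1..r}"
    and "\<And>u. u \<in> tuples r G \<Longrightarrow> c u \<in> carrier G" "\<And>u. u \<in> tuples r G \<Longrightarrow> d u \<in> carrier G"
    and "\<And>u. u \<in> tuples r G \<Longrightarrow> d (u(i := c u)) = u i"
    and "\<And>u. u \<in> tuples r G \<Longrightarrow> c (u(i := d u)) = u i"
  shows "change r G i c \<in> Bij (tuples r G)"
    "inv\<^bsub>BijGroup (tuples r G)\<^esub> (change r G i c) = change r G i d"
  by (rule Bij_and_inverseI[of _ _ "change r G i d"];
      use assms in \<open>auto simp: change_def tuples_upd\<close>)+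

lemma ac_symbols_iff [simp]:
  "AC1 i j \<in> ac_symbols r \<longleftrightarrow> i \<in> {1..r} \<and> j \<in> {1..r} \<and> i \<noteq> j"
  "AC2 i j \<in> ac_symbols r \<longleftrightarrow> i \<in> {1..r} \<and> j \<in> {1..r} \<and> i \<noteq> j"
  "AC3 i \<in> ac_symbols r \<longleftrightarrow> i \<in> {1..r}"
  "AC4 i k \<in> ac_symbols r \<longleftrightarrow> i \<in> {1..r} \<and> k \<in> {1..r}"
  by (simp_all add: ac_symbols_def)

lemma AC4_word_lists:
  assumes "i \<in> {1..r}" "v \<in> lists ({1..r} \<times> UNIV)"
  shows "map (apfst (AC4 i)) v \<in> lists (ac_symbols r \<times> UNIV)"
  using assms(2) by induction (use assms(1) in auto)

section \<open>The substitution words of a product of moves\<close>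

primrec ac_index :: "ac_symbol \<Rightarrow> nat" where
  "ac_index (AC1 i j) = i"
| "ac_index (AC2 i j) = i"
| "ac_index (AC3 i) = i"
| "ac_index (AC4 i k) = i"

text \<open>In the words below, \<open>Inl i\<close> stands for the component \<open>u\<^sub>i\<close> and \<open>Inr k\<close> for the conjugator
  \<open>z\<^sub>k\<close>.\<close>

fun ac_word :: "ac_symbol \<times> bool \<Rightarrow> (nat \<Rightarrow> ((nat + nat) \<times> bool) list) \<Rightarrow> ((nat + nat) \<times> bool) list"
  where
  "ac_word (AC1 i j, e) U = U i @ (if e then U j else inv_word (U j))"
| "ac_word (AC2 i j, e) U = (if e then U j else inv_word (U j)) @ U i"
| "ac_word (AC3 i, e) U = inv_word (U i)"
| "ac_word (AC4 i k, e) U = (Inr k, e) # U i @ [(Inr k, \<not> e)]"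

text \<open>The head of the list is the factor applied last, so its word is built from the words of
  the tail.\<close>

primrec prod_words :: "(ac_symbol \<times> bool) list \<Rightarrow> nat \<Rightarrow> ((nat + nat) \<times> bool) list" where
  "prod_words [] = (\<lambda>i. [(Inl i, True)])"
| "prod_words (a # w) = (prod_words w)(ac_index (fst a) := ac_word a (prod_words w))"

abbreviation letters :: "nat \<Rightarrow> ((nat + nat) \<times> bool) set" where
  "letters r \<equiv> ({1..r} <+> {1..r}) \<times> UNIV"

lemma ac_word_lists:
  assumes "s \<in> ac_symbols r" "\<And>i. i \<in> {1..r} \<Longrightarrow> U i \<in> lists (letters r)"
  shows "ac_word (s, e) U \<in> lists (letters r)"
  using assms(1)
  by (cases s) (simp_all add: ac_symbols_def assms(2) inv_word_lists InlI InrI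
      del: in_lists_conv_set atLeastAtMost_iff)

lemma ac_index_symbols: "s \<in> ac_symbols r \<Longrightarrow> ac_index s \<in> {1..r}"
  by (auto simp: ac_symbols_def)

lemma prod_words_lists:
  assumes "w \<in> lists (ac_symbols r \<times> UNIV)" "i \<in> {1..r}"
  shows "prod_words w i \<in> lists (letters r)"
  using assms
proof (induction w arbitrary: i)
  case (Cons a w)
  obtain s e where a: "a = (s, e)"
    by fastforce
  have "ac_word (s, e) (prod_words w) \<in> lists (letters r)"
    using Cons a by (intro ac_word_lists) auto
  with Cons show ?case
    by (simp add: a)
qed auto

section \<open>Evaluation of moves and their products in a group\<close>

context group
begin

text \<open>The inverse of a move again changes one component, so one formula with a sign covers
  both; \<open>AC3\<close> is an involution.\<close>

fun ac_value :: "(nat \<Rightarrow> 'a) \<Rightarrow> ac_symbol \<times> bool \<Rightarrow> (nat \<Rightarrow> 'a) \<Rightarrow> 'a" where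
  "ac_value z (AC1 i j, e) u = u i \<otimes> (if e then u j else inv (u j))"
| "ac_value z (AC2 i j, e) u = (if e then u j else inv (u j)) \<otimes> u i"
| "ac_value z (AC3 i, e) u = inv (u i)"
| "ac_value z (AC4 i k, e) u = conj_by G (u i) (if e then z k else inv (z k))"

lemma ac_map_eq_change: "ac_map r G z s = change r G (ac_index s) (ac_value z (s, True))"
  by (cases s) (simp_all add: change_def)

lemma ac_value_closed:
  assumes "s \<in> ac_symbols r" "z \<in> {1..r} \<rightarrow> carrier G" "u \<in> tuples r G"
  shows "ac_value z (s, e) u \<in> carrier G"
  using assms by (auto simp: ac_symbols_def conj_by_def Pi_iff)

text \<open>A move leaves its conjugator and, as \<open>i\<close> and \<open>j\<close> differ, its
  multiplier untouched, so the opposite sign cancels the same factor.\<close>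

lemma ac_value_cancel:
  assumes "s \<in> ac_symbols r" "z \<in> {1..r} \<rightarrow> carrier G" "u \<in> tuples r G"
  shows "ac_value z (s, \<not> e) (u(ac_index s := ac_value z (s, e) u)) = u (ac_index s)"
proof -
  have cancel: "a \<otimes> b \<otimes> inv b = a" "a \<otimes> inv b \<otimes> b = a" "b \<otimes> (inv b \<otimes> a) = a"
    "inv b \<otimes> (b \<otimes> a) = a" if "a \<in> carrier G" "b \<in> carrier G" for a b
    using that by (simp_all add: m_assoc) (simp_all flip: m_assoc)
  show ?thesis
    using assms by (cases e) (auto simp: ac_symbols_def conj_by_def Pi_iff cancel m_assoc)
qed

lemma ac_map_Bij:
  assumes "s \<in> ac_symbols r" "z \<in> {1..r} \<rightarrow> carrier G"
  shows "ac_map r G z s \<in> Bij (tuples r G)"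
    "inv\<^bsub>BijGroup (tuples r G)\<^esub> (ac_map r G z s) =
      change r G (ac_index s) (ac_value z (s, False))"
  unfolding ac_map_eq_change
  using change_Bij[OF ac_index_symbols[OF assms(1)], of G "ac_value z (s, True)"
      "ac_value z (s, False)"]
    ac_value_closed[OF assms] ac_value_cancel[OF assms, where e = True]
    ac_value_cancel[OF assms, where e = False]
  by simp_all

lemma signed_ac_map:
  assumes "s \<in> ac_symbols r" "z \<in> {1..r} \<rightarrow> carrier G"
  shows "(if e then ac_map r G z s else inv\<^bsub>BijGroup (tuples r G)\<^esub> (ac_map r G z s)) =
    change r G (ac_index s) (ac_value z (s, e))"
  using ac_map_Bij(2)[OF assms] ac_map_eq_change by (cases e) simp_all

lemma ac_map_funcset:
  "z \<in> {1..r} \<rightarrow> carrier G \<Longrightarrow>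
    ac_map r G z \<in> ac_symbols r \<rightarrow> carrier (BijGroup (tuples r G))"
  using ac_map_Bij(1) by auto

lemma ac_prod_Bij:
  assumes "z \<in> {1..r} \<rightarrow> carrier G" "w \<in> lists (ac_symbols r \<times> UNIV)"
  shows "ac_prod r G z w \<in> Bij (tuples r G)"
  using group.word_val_closed[OF group_BijGroup ac_map_funcset[OF assms(1)] assms(2)]
  by (simp add: ac_prod_def)

lemma ac_prod_Nil: "ac_prod r G z [] = (\<lambda>u \<in> tuples r G. u)"
  by (simp add: ac_prod_def group.word_val_Nil[OF group_BijGroup])

lemma ac_prod_Cons:
  assumes "z \<in> {1..r} \<rightarrow> carrier G" "s \<in> ac_symbols r" "w \<in> lists (ac_symbols r \<times> UNIV)"
  shows "ac_prod r G z ((s, e) # w) =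
    compose (tuples r G) (change r G (ac_index s) (ac_value z (s, e))) (ac_prod r G z w)"
proof -
  interpret B: group "BijGroup (tuples r G)"
    by (rule group_BijGroup)
  have "change r G (ac_index s) (ac_value z (s, e)) \<in> Bij (tuples r G)"
    using ac_map_Bij(1)[OF assms(2,1)] B.inv_closed[of "ac_map r G z s"]
    by (simp flip: signed_ac_map[OF assms(2,1)])
  then show ?thesis
    using ac_prod_Bij[OF assms(1,3)] signed_ac_map[OF assms(2,1), of e]
    by (simp only: ac_prod_def B.word_val_Cons fst_conv snd_conv BijGroup_simps)
qed

lemma ac_prod_tuples:
  assumes "z \<in> {1..r} \<rightarrow> carrier G" "w \<in> lists (ac_symbols r \<times> UNIV)" "u \<in> tuples r G"
  shows "ac_prod r G z w u \<in> tuples r G"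
  using Bij_imp_funcset[OF ac_prod_Bij[OF assms(1,2)]] assms(3) by auto

lemma ac_prod_Cons_apply:
  assumes "z \<in> {1..r} \<rightarrow> carrier G" "s \<in> ac_symbols r" "w \<in> lists (ac_symbols r \<times> UNIV)"
    and "u \<in> tuples r G"
  shows "ac_prod r G z ((s, e) # w) u =
    (ac_prod r G z w u)(ac_index s := ac_value z (s, e) (ac_prod r G z w u))"
  using ac_prod_tuples[OF assms(1,3,4)] assms(4)
  by (simp add: ac_prod_Cons[OF assms(1-3)] compose_eq change_def)

text \<open>Induction step for products: evaluation turns concatenation into multiplication and
  \<open>inv_word\<close> into inversion.\<close>

lemma word_val_ac_word:
  assumes b: "case_sum u z \<in> {1..r} <+> {1..r} \<rightarrow> carrier G" and s: "s \<in> ac_symbols r"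
    and U: "\<And>i. i \<in> {1..r} \<Longrightarrow> U i \<in> lists (letters r)"
    and v: "\<And>i. i \<in> {1..r} \<Longrightarrow> v i = word_val G (case_sum u z) (U i)"
  shows "word_val G (case_sum u z) (ac_word (s, e) U) = ac_value z (s, e) v"
proof -
  have inr: "[(Inr k, e')] \<in> lists (letters r)" and z: "z k \<in> carrier G"
    if "k \<in> {1..r}" for k e'
    using that b by (auto simp: Pi_iff split: sum.splits)
  note simps = word_val_append[OF b] word_val_inv_word[OF b] inv_word_lists U v
    word_val_closed[OF b]
  show ?thesis
    using s
  proof (cases s)
    case (AC4 i k)
    with s have ik: "i \<in> {1..r}" "k \<in> {1..r}"
      by (auto simp: ac_symbols_def)
    have "word_val G (case_sum u z) (U i @ [(Inr k, \<not> e)]) =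
        word_val G (case_sum u z) (U i) \<otimes> word_val G (case_sum u z) [(Inr k, \<not> e)]"
      using U[OF ik(1)] inr[OF ik(2)] by (rule word_val_append[OF b])
    then show ?thesis
      using AC4 ik z[OF ik(2)] U[OF ik(1)] v[OF ik(1)]
      by (simp add: word_val_Cons conj_by_def m_assoc word_val_closed[OF b] del: in_lists_conv_set)
  qed (auto simp: ac_symbols_def simps simp del: in_lists_conv_set)
qed

text \<open>This makes products over different groups comparable: \<open>prod_words w\<close>
  involves neither the group nor \<open>z\<close>.\<close>

lemma ac_prod_eq_word_val:
  assumes z: "z \<in> {1..r} \<rightarrow> carrier G" and w: "w \<in> lists (ac_symbols r \<times> UNIV)"
    and u: "u \<in> tuples r G" and "i \<in> {1..r}"
  shows "ac_prod r G z w u i = word_val G (case_sum u z) (prod_words w i)"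
  using w \<open>i \<in> {1..r}\<close>
proof (induction w arbitrary: i)
  case Nil
  then show ?case
    using u by (simp add: ac_prod_Nil word_val_single)
next
  case (Cons a w)
  obtain s e where a: "a = (s, e)"
    by fastforce
  have s: "s \<in> ac_symbols r" and w: "w \<in> lists (ac_symbols r \<times> UNIV)"
    using Cons a by auto
  have b: "case_sum u z \<in> {1..r} <+> {1..r} \<rightarrow> carrier G"
    using u z by (auto simp: Pi_iff)
  have "word_val G (case_sum u z) (ac_word (s, e) (prod_words w)) =
      ac_value z (s, e) (ac_prod r G z w u)"
    using prod_words_lists[OF w] Cons.IH by (intro word_val_ac_word[OF b s]) auto
  then show ?case
    using Cons.IH[OF Cons.prems] by (simp add: a ac_prod_Cons_apply[OF z s w u])
qed

lemma ac_prod_fixes_iff: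
  assumes "z \<in> {1..r} \<rightarrow> carrier G" "w \<in> lists (ac_symbols r \<times> UNIV)" "u \<in> tuples r G"
  shows "ac_prod r G z w u = u \<longleftrightarrow>
    (\<forall>i \<in> {1..r}. word_val G (case_sum u z) (prod_words w i) = u i)"
proof -
  have "ac_prod r G z w u = u \<longleftrightarrow> (\<forall>i \<in> {1..r}. ac_prod r G z w u i = u i)"
    using ac_prod_tuples[OF assms] assms(3) unfolding tuples_def
    by (metis PiE_ext)
  then show ?thesis
    using ac_prod_eq_word_val[OF assms] by simp
qed


lemma ac_prod_single:
  assumes "z \<in> {1..r} \<rightarrow> carrier G" "s \<in> ac_symbols r"
  shows "ac_prod r G z [(s, e)] = change r G (ac_index s) (ac_value z (s, e))"
  using ac_map_Bij(1)[OF assms(2,1)] signed_ac_map[OF assms(2,1), of e]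
    group.word_val_single[OF group_BijGroup, of "ac_map r G z" s "tuples r G" e]
  by (simp add: ac_prod_def)

section \<open>Elementary moves as products of the generating transformations\<close>

text \<open>Conjugation is a left action, so conjugating by a word composes the conjugations by its
  letters in the same order.\<close>

lemma conj_move_eq_ac_prod:
  assumes x: "x \<in> {1..r} \<rightarrow> carrier G" and i: "i \<in> {1..r}" and "v \<in> lists ({1..r} \<times> UNIV)"
  shows "change r G i (\<lambda>u. conj_by G (u i) (word_val G x v)) =
    ac_prod r G x (map (apfst (AC4 i)) v)"
  using assms(3)
proof (induction v)
  case Nil
  show ?case
    using i by (auto simp: ac_prod_Nil change_def fun_eq_iff conj_by_def)
next
  case (Cons a v)
  obtain k e where a: "a = (k, e)"
    by fastforce
  then have k: "k \<in> {1..r}" and v: "v \<in> lists ({1..r} \<times> UNIV)"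
    using Cons by auto
  have carr: "letter_val x a \<in> carrier G" "word_val G x v \<in> carrier G"
    using x k v a by (auto simp: Pi_iff intro: word_val_closed[OF x])
  have sym: "AC4 i k \<in> ac_symbols r" "map (apfst (AC4 i)) v \<in> lists (ac_symbols r \<times> UNIV)"
    using i k AC4_word_lists[OF i v] by simp_all
  have "ac_prod r G x (map (apfst (AC4 i)) (a # v)) =
      compose (tuples r G) (change r G i (ac_value x (AC4 i k, e)))
        (change r G i (\<lambda>u. conj_by G (u i) (word_val G x v)))"
    using ac_prod_Cons[OF x sym, of e] Cons.IH by (simp add: a)
  also have "\<dots> = change r G i (\<lambda>u. conj_by G (u i) (letter_val x a \<otimes> word_val G x v))"
    using i carr
    by (auto simp: fun_eq_iff compose_def change_def tuples_upd conj_by_def a m_assoc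
        inv_mult_group)
  finally show ?case
    by (simp add: word_val_Cons)
qed

text \<open>Only conjugation by a general element takes more than one signed symbol: that element is
  a word in \<open>x\<close>, whose letters give the factors.\<close>

lemma AC_moves_eq_ac_prod:
  assumes x: "x \<in> {1..r} \<rightarrow> carrier G" and gen: "generate G (x ` {1..r}) = carrier G"
    and "m \<in> AC_moves r G"
  shows "\<exists>w \<in> lists (ac_symbols r \<times> UNIV). m = ac_prod r G x w"
proof -
  have single: ?thesis
    if "s \<in> ac_symbols r" "m = change r G (ac_index s) (ac_value x (s, e))" for s e
    using that ac_prod_single[OF x that(1), of e] by (intro bexI[of _ "[(s, e)]"]) auto
  have R: ?thesis
    if "m = change r G i (\<lambda>u. u i \<otimes> u j)" "i \<in> {1..r}" "j \<in> {1..r}" "i \<noteq> j" for i j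
    using that by (intro single[of "AC1 i j" True]) (simp_all add: change_def)
  have R': ?thesis
    if "m = change r G i (\<lambda>u. u i \<otimes> inv (u j))" "i \<in> {1..r}" "j \<in> {1..r}" "i \<noteq> j" for i j
    using that by (intro single[of "AC1 i j" False]) (simp_all add: change_def)
  have L: ?thesis
    if "m = change r G i (\<lambda>u. u j \<otimes> u i)" "i \<in> {1..r}" "j \<in> {1..r}" "i \<noteq> j" for i j
    using that by (intro single[of "AC2 i j" True]) (simp_all add: change_def)
  have L': ?thesis
    if "m = change r G i (\<lambda>u. inv (u j) \<otimes> u i)" "i \<in> {1..r}" "j \<in> {1..r}" "i \<noteq> j" for i j
    using that by (intro single[of "AC2 i j" False]) (simp_all add: change_def)
  have I: ?thesis if "m = change r G i (\<lambda>u. inv (u i))" "i \<in> {1..r}" for i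
    using that by (intro single[of "AC3 i" True]) (simp_all add: change_def)
  have C: ?thesis
    if "m = change r G i (\<lambda>u. conj_by G (u i) h)" "i \<in> {1..r}" "h \<in> carrier G" for i h
  proof -
    have "h \<in> word_val G x ` lists ({1..r} \<times> UNIV)"
      using that(3) by (simp add: gen flip: generate_word_val[OF x])
    then obtain v where v: "h = word_val G x v" "v \<in> lists ({1..r} \<times> UNIV)"
      by (elim imageE)
    show ?thesis
      using that v AC4_word_lists[OF _ v(2)] conj_move_eq_ac_prod[OF x _ v(2), of i]
      by (intro bexI[of _ "map (apfst (AC4 i)) v"]) simp_all
  qed
  from assms(3) show ?thesis
    unfolding AC_moves_def Un_iff mem_Collect_eq
    by (elim disjE exE conjE) (rule R R' L L' I C; assumption)+
qed

lemma ac_map_in_AC_moves: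
  assumes "x \<in> {1..r} \<rightarrow> carrier G"
  shows "ac_map r G x ` ac_symbols r \<subseteq> AC_moves r G"
proof
  fix m assume "m \<in> ac_map r G x ` ac_symbols r"
  then obtain s where s: "s \<in> ac_symbols r" "m = ac_map r G x s"
    by blast
  show "m \<in> AC_moves r G"
  proof (cases s)
    case (AC4 i k)
    with s assms have "i \<in> {1..r}" "x k \<in> carrier G" "m = change r G i (\<lambda>u. conj_by G (u i) (x k))"
      by (auto simp: ac_symbols_def Pi_iff)
    then show ?thesis
      unfolding AC_moves_def by blast
  qed (use s in \<open>simp add: ac_symbols_def AC_moves_def; blast\<close>)+
qed

end

section \<open>The action on normally generating tuples\<close>

context group
begin

section \<open>Invariance of normal generation under moves\<close>

lemma normal_carrier: "carrier G \<lhd> G"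
  by (rule normal_invI) (auto intro: subgroup_self)

text \<open>The carrier is itself normal, so for a normally generating tuple the intersected family
  is exactly \<open>{carrier G}\<close>.\<close>

lemma NGen_iff:
  "u \<in> NGen r G \<longleftrightarrow>
    u \<in> tuples r G \<and> (\<forall>N. N \<lhd> G \<and> u ` {1..r} \<subseteq> N \<longrightarrow> N = carrier G)"
proof -
  have "normal_closure G (u ` {1..r}) = carrier G \<longleftrightarrow>
      (\<forall>N. N \<lhd> G \<and> u ` {1..r} \<subseteq> N \<longrightarrow> N = carrier G)" if "u \<in> tuples r G"
  proof
    assume "normal_closure G (u ` {1..r}) = carrier G"
    then show "\<forall>N. N \<lhd> G \<and> u ` {1..r} \<subseteq> N \<longrightarrow> N = carrier G"
      unfolding normal_closure_def using normal_imp_subgroup subgroup.subset by blast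
  next
    assume "\<forall>N. N \<lhd> G \<and> u ` {1..r} \<subseteq> N \<longrightarrow> N = carrier G"
    moreover have "u ` {1..r} \<subseteq> carrier G"
      using that by auto
    ultimately have "{N. N \<lhd> G \<and> u ` {1..r} \<subseteq> N} = {carrier G}"
      using normal_carrier by blast
    then show "normal_closure G (u ` {1..r}) = carrier G"
      by (simp add: normal_closure_def)
  qed
  then show ?thesis
    by (auto simp: NGen_def)
qed

lemma ac_value_normal:
  assumes "N \<lhd> G" "s \<in> ac_symbols r" "z \<in> {1..r} \<rightarrow> carrier G" "u ` {1..r} \<subseteq> N"
  shows "ac_value z (s, e) u \<in> N"
proof -
  interpret N: normal N G by fact
  have "u i \<in> N" if "i \<in> {1..r}" for i
    using that assms(4) by auto
  then show ?thesis
    using assms(2,3) by (auto simp: ac_symbols_def conj_by_def Pi_iff N.inv_op_closed2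
        N.inv_op_closed1 dest: N.inv_op_closed2)
qed

text \<open>The opposite move recovers the old entry, so a normal subgroup containing the new
  entries contains the old ones.\<close>

lemma NGen_ac_value:
  assumes s: "s \<in> ac_symbols r" and z: "z \<in> {1..r} \<rightarrow> carrier G" and u: "u \<in> NGen r G"
  shows "u(ac_index s := ac_value z (s, e) u) \<in> NGen r G" (is "?v \<in> _")
proof -
  have u': "u \<in> tuples r G"
    using u by (simp add: NGen_def)
  have "N = carrier G" if N: "N \<lhd> G" "?v ` {1..r} \<subseteq> N" for N
  proof -
    have "ac_value z (s, \<not> e) ?v \<in> N"
      using ac_value_normal[OF N(1) s z N(2)] .
    then have "u (ac_index s) \<in> N"
      using ac_value_cancel[OF s z u'] by simp
    with N(2) have "u ` {1..r} \<subseteq> N"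
      by (fastforce split: if_splits)
    with u N(1) show ?thesis
      by (simp add: NGen_iff)
  qed
  then show ?thesis
    using tuples_upd[OF u' ac_index_symbols[OF s] ac_value_closed[OF s z u']]
    by (simp add: NGen_iff)
qed

lemma NGen_subset: "NGen r G \<subseteq> tuples r G"
  by (auto simp: NGen_def)

lemma restrict_ac_map_Bij:
  assumes "s \<in> ac_symbols r" "z \<in> {1..r} \<rightarrow> carrier G"
  shows "restrict (ac_map r G z s) (NGen r G) \<in> Bij (NGen r G)"
    "inv\<^bsub>BijGroup (NGen r G)\<^esub> (restrict (ac_map r G z s) (NGen r G)) =
      restrict (change r G (ac_index s) (ac_value z (s, False))) (NGen r G)"
proof -
  let ?m = "\<lambda>e. restrict (change r G (ac_index s) (ac_value z (s, e))) (NGen r G)"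
  have m: "?m e u = u(ac_index s := ac_value z (s, e) u)" "?m e u \<in> NGen r G"
    "?m (\<not> e) (?m e u) = u" if "u \<in> NGen r G" for e u
  proof -
    have "u \<in> tuples r G"
      using that NGen_subset by blast
    then show *: "?m e u = u(ac_index s := ac_value z (s, e) u)" "?m e u \<in> NGen r G"
      using that NGen_ac_value[OF assms that, of e] by (simp_all add: change_def)
    then show "?m (\<not> e) (?m e u) = u"
      using NGen_subset[of r] ac_value_cancel[OF assms \<open>u \<in> tuples r G\<close>, of e]
      by (auto simp: change_def)
  qed
  have "?m True \<in> Bij (NGen r G) \<and> inv\<^bsub>BijGroup (NGen r G)\<^esub> (?m True) = ?m False"
  proof -
    have "?m False (?m True u) = u" "?m True (?m False u) = u" if "u \<in> NGen r G" for u
      using m(3)[OF that, of True] m(3)[OF that, of False]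
      by (simp_all only: not_True_eq_False not_False_eq_True)
    with m(2) show ?thesis
      by (intro conjI Bij_and_inverseI[of "?m True" "NGen r G" "?m False"]) simp_all
  qed
  then show "restrict (ac_map r G z s) (NGen r G) \<in> Bij (NGen r G)"
    "inv\<^bsub>BijGroup (NGen r G)\<^esub> (restrict (ac_map r G z s) (NGen r G)) = ?m False"
    by (simp_all add: ac_map_eq_change)
qed

abbreviation ac_map_NGen :: "nat \<Rightarrow> (nat \<Rightarrow> 'a) \<Rightarrow> ac_symbol \<Rightarrow> (nat \<Rightarrow> 'a) \<Rightarrow> (nat \<Rightarrow> 'a)"
  where "ac_map_NGen r z \<equiv> \<lambda>s. restrict (ac_map r G z s) (NGen r G)"

text \<open>Restriction commutes with composition because products map \<open>NGen r G\<close> into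
  itself.\<close>

lemma word_val_ac_map_NGen:
  assumes z: "z \<in> {1..r} \<rightarrow> carrier G" and "w \<in> lists (ac_symbols r \<times> UNIV)"
  shows "word_val (BijGroup (NGen r G)) (ac_map_NGen r z) w = restrict (ac_prod r G z w) (NGen r G)"
  using assms(2)
proof (induction w)
  case Nil
  show ?case
    using NGen_subset by (auto simp: group.word_val_Nil[OF group_BijGroup] ac_prod_Nil fun_eq_iff)
next
  case (Cons a w)
  interpret B: group "BijGroup (NGen r G)"
    by (rule group_BijGroup)
  obtain s e where a: "a = (s, e)"
    by fastforce
  have s: "s \<in> ac_symbols r" and w: "w \<in> lists (ac_symbols r \<times> UNIV)"
    using Cons a by auto
  let ?m = "restrict (change r G (ac_index s) (ac_value z (s, e))) (NGen r G)"
  have m: "B.letter_val (ac_map_NGen r z) a = ?m"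
    using restrict_ac_map_Bij(2)[OF s z] by (simp add: a ac_map_eq_change)
  have "?m \<in> Bij (NGen r G)"
    using m restrict_ac_map_Bij(1)[OF s z] B.inv_closed[of "ac_map_NGen r z s"]
    by (simp add: a split: if_splits)
  moreover have W: "restrict (ac_prod r G z w) (NGen r G) \<in> Bij (NGen r G)"
  proof -
    have "ac_map_NGen r z \<in> ac_symbols r \<rightarrow> carrier (BijGroup (NGen r G))"
      using restrict_ac_map_Bij(1)[OF _ z] by simp
    from B.word_val_closed[OF this w] show ?thesis
      unfolding Cons.IH BijGroup_simps .
  qed
  ultimately have "word_val (BijGroup (NGen r G)) (ac_map_NGen r z) (a # w) =
      compose (NGen r G) ?m (restrict (ac_prod r G z w) (NGen r G))"
    using Cons.IH m by (simp only: B.word_val_Cons BijGroup_simps)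
  also have "\<dots> = restrict (ac_prod r G z (a # w)) (NGen r G)"
  proof -
    have "ac_prod r G z w u \<in> NGen r G" "u \<in> tuples r G" if "u \<in> NGen r G" for u
      using that funcset_mem[OF Bij_imp_funcset[OF W] that] NGen_subset by auto
    then show ?thesis
      unfolding a ac_prod_Cons[OF z s w] by (simp add: fun_eq_iff compose_def)
  qed
  finally show ?case .
qed

section \<open>Generating families of \<open>GAC\<close> and \<open>AC\<close> indexed by the
  symbols\<close>

lemma subgroup_generated_eqI:
  assumes "S \<subseteq> T" "T \<subseteq> generate G S" "S \<subseteq> carrier G"
  shows "subgroup_generated G T = subgroup_generated G S"
proof -
  have "T \<subseteq> carrier G"
    using assms(2) generate_incl[OF assms(3)] by blast
  moreover have "generate G T = generate G S"
    using mono_generate[OF assms(1)] generate_subgroup_incl[OF assms(2)]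
      generate_is_subgroup[OF assms(3)] by blast
  ultimately show ?thesis
    using assms(3) by (simp add: subgroup_generated_def Int_absorb1)
qed

text \<open>Conjugations by the generators \<open>x k\<close> produce all others, which gives
  \<open>GAC\<close> a generating family with the same index set as that of
  \<open>A_rr\<close>.\<close>

lemma GAC_eq:
  assumes "x \<in> {1..r} \<rightarrow> carrier G" "generate G (x ` {1..r}) = carrier G"
  shows "GAC r G = subgroup_generated (BijGroup (tuples r G)) (ac_map r G x ` ac_symbols r)"
proof -
  interpret B: group "BijGroup (tuples r G)"
    by (rule group_BijGroup)
  show ?thesis
    unfolding GAC_def
  proof (rule B.subgroup_generated_eqI)
    show "AC_moves r G \<subseteq> generate (BijGroup (tuples r G)) (ac_map r G x ` ac_symbols r)"
      unfolding B.generate_word_val[OF ac_map_funcset[OF assms(1)]]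
      using AC_moves_eq_ac_prod[OF assms] unfolding ac_prod_def by blast
  qed (use ac_map_in_AC_moves[OF assms(1)] ac_map_funcset[OF assms(1)] in auto)
qed

lemma AC_eq:
  assumes x: "x \<in> {1..r} \<rightarrow> carrier G" and gen: "generate G (x ` {1..r}) = carrier G"
  shows "AC r G = subgroup_generated (BijGroup (NGen r G)) (ac_map_NGen r x ` ac_symbols r)"
proof -
  interpret B: group "BijGroup (NGen r G)"
    by (rule group_BijGroup)
  have b: "ac_map_NGen r x \<in> ac_symbols r \<rightarrow> carrier (BijGroup (NGen r G))"
    using restrict_ac_map_Bij(1)[OF _ x] by auto
  show ?thesis
    unfolding AC_def
  proof (rule B.subgroup_generated_eqI)
    show "(\<lambda>m. restrict m (NGen r G)) ` AC_moves r G \<subseteq>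
        generate (BijGroup (NGen r G)) (ac_map_NGen r x ` ac_symbols r)"
      unfolding B.generate_word_val[OF b]
    proof (rule image_subsetI)
      fix m assume "m \<in> AC_moves r G"
      from AC_moves_eq_ac_prod[OF x gen this] obtain w
        where w: "w \<in> lists (ac_symbols r \<times> UNIV)" "m = ac_prod r G x w"
        by (elim bexE)
      then have "restrict m (NGen r G) = word_val (BijGroup (NGen r G)) (ac_map_NGen r x) w"
        by (simp only: word_val_ac_map_NGen[OF x])
      from this w(1) show "restrict m (NGen r G) \<in>
          word_val (BijGroup (NGen r G)) (ac_map_NGen r x) ` lists (ac_symbols r \<times> UNIV)"
        by (rule image_eqI)
    qed
  qed (use ac_map_in_AC_moves[OF x] b in auto)
qed

end

section \<open>Detecting trivial products\<close>

text \<open>The tested word is W_i u_i^-1. Neither a group nor conjugators occur, so the condition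
  can serve all three groups at once.\<close>

definition trivial_words :: "nat \<Rightarrow> (ac_symbol \<times> bool) list \<Rightarrow> bool" where
  "trivial_words r w \<longleftrightarrow>
     (\<forall>i \<in> {1..r}. foldr push (prod_words w i @ inv_word [(Inl i, True)]) [] = [])"

lemma Inl_letter: "i \<in> {1..r} \<Longrightarrow> [(Inl i, e)] \<in> lists (letters r)"
  by auto

lemma word_val_cong:
  assumes "w \<in> lists (I \<times> UNIV)" "\<And>i. i \<in> I \<Longrightarrow> b i = c i"
  shows "word_val G b w = word_val G c w"
  using assms(1) by (induction w) (auto simp: word_val_def assms(2))

context group
begin

lemma trivial_words_fixes:
  assumes "trivial_words r w" and z: "z \<in> {1..r} \<rightarrow> carrier G"
    and w: "w \<in> lists (ac_symbols r \<times> UNIV)" and u: "u \<in> tuples r G"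
  shows "ac_prod r G z w u = u"
  unfolding ac_prod_fixes_iff[OF z w u]
proof
  fix i assume i: "i \<in> {1..r}"
  have b: "case_sum u z \<in> {1..r} <+> {1..r} \<rightarrow> carrier G"
    using u z by (auto simp: Pi_iff)
  have "word_val G (case_sum u z) (prod_words w i) = word_val G (case_sum u z) [(Inl i, True)]"
    using word_val_eqI[OF b prod_words_lists[OF w i] Inl_letter[OF i]] assms(1) i
    unfolding trivial_words_def by blast
  then show "word_val G (case_sum u z) (prod_words w i) = u i"
    using u i by (simp add: word_val_single)
qed

text \<open>One tuple suffices: evaluated at \<open>f\<close> and \<open>y\<close>, the words become
  words in a free basis, so equal values force full cancellation.\<close>

lemma fixes_basis_trivial_words:
  assumes free: "free_basis G ({1..r} <+> {1..r}) (case_sum f y)"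
    and w: "w \<in> lists (ac_symbols r \<times> UNIV)"
    and fixed: "ac_prod r G y w (restrict f {1..r}) = restrict f {1..r}"
  shows "trivial_words r w"
  unfolding trivial_words_def
proof
  fix i assume i: "i \<in> {1..r}"
  have b: "case_sum f y \<in> {1..r} <+> {1..r} \<rightarrow> carrier G"
    using free by (simp add: free_basis_def)
  have f: "restrict f {1..r} \<in> tuples r G" and y: "y \<in> {1..r} \<rightarrow> carrier G"
    using b by (auto simp: tuples_def Pi_iff split: sum.splits)
  have "word_val G (case_sum f y) (prod_words w i) =
      word_val G (case_sum (restrict f {1..r}) y) (prod_words w i)"
    by (rule word_val_cong[OF prod_words_lists[OF w i]]) auto
  also have "\<dots> = f i"
    using fixed i unfolding ac_prod_fixes_iff[OF y w f] by simp
  also have "\<dots> = word_val G (case_sum f y) [(Inl i, True)]"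
    using f i by (auto simp: word_val_single tuples_def PiE_iff)
  finally show "foldr push (prod_words w i @ inv_word [(Inl i, True)]) [] = []"
    using free_basis_word_val_eq[OF free prod_words_lists[OF w i] Inl_letter[OF i]] by blast
qed

text \<open>Used with \<open>subst_letter N\<close> as \<open>\<sigma>\<close>, to pass from values
  at the conjugated tuple to values at the basis.\<close>

lemma word_val_concat_map:
  assumes b: "b \<in> I \<rightarrow> carrier G" and "V \<in> lists L"
    and \<sigma>: "\<And>a. a \<in> L \<Longrightarrow> \<sigma> a \<in> lists (I \<times> UNIV)"
      "\<And>a. a \<in> L \<Longrightarrow> letter_val c a = word_val G b (\<sigma> a)"
  shows "word_val G c V = word_val G b (concat (map \<sigma> V))
    \<and> concat (map \<sigma> V) \<in> lists (I \<times> UNIV)"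
  using assms(2)
proof (induction V)
  case (Cons a V)
  then have "\<sigma> a \<in> lists (I \<times> UNIV)" "concat (map \<sigma> V) \<in> lists (I \<times> UNIV)"
    using \<sigma>(1) by auto
  then show ?case
    using word_val_append[OF b] Cons \<sigma>(2)[of a] by (simp add: word_val_Cons)
qed simp

text \<open>Conjugating back inside a normal subgroup recovers each \<open>x i\<close>, and these
  generate the group.\<close>

lemma conjugates_NGen:
  assumes x: "x \<in> {1..r} \<rightarrow> carrier G" and gen: "generate G (x ` {1..r}) = carrier G"
    and g: "g \<in> {1..r} \<rightarrow> carrier G"
  shows "(\<lambda>i \<in> {1..r}. conj_by G (x i) (g i)) \<in> NGen r G" (is "?u \<in> _")
proof -
  have "N = carrier G" if N: "N \<lhd> G" "?u ` {1..r} \<subseteq> N" for N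
  proof -
    interpret N: normal N G by fact
    have "x i \<in> N" if i: "i \<in> {1..r}" for i
    proof -
      have carr: "x i \<in> carrier G" "g i \<in> carrier G"
        using x g i by auto
      have "?u i \<in> N"
        using N(2) i by blast
      then have "conj_by G (x i) (g i) \<in> N"
        using i by simp
      then have "inv (g i) \<otimes> conj_by G (x i) (g i) \<otimes> g i \<in> N"
        using carr by (intro N.inv_op_closed1)
      also have "inv (g i) \<otimes> conj_by G (x i) (g i) \<otimes> g i = x i"
        using carr by (simp add: conj_by_def m_assoc) (simp flip: m_assoc)
      finally show ?thesis .
    qed
    then have "generate G (x ` {1..r}) \<subseteq> N"
      by (intro generate_subgroup_incl) (auto intro: N.subgroup_axioms)
    with gen N.subset show ?thesis
      by blast
  qed
  moreover have "?u \<in> tuples r G"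
    using x g by (auto simp: tuples_def conj_by_def Pi_iff)
  ultimately show ?thesis
    by (simp add: NGen_iff)
qed

text \<open>Each word that fails to cancel is detected by a tuple of conjugates chosen to suit that
  word.\<close>

lemma fixes_NGen_trivial_words:
  assumes free: "free_basis G {1..r} x" and "r \<ge> 2"
    and w: "w \<in> lists (ac_symbols r \<times> UNIV)"
    and fixed: "\<And>u. u \<in> NGen r G \<Longrightarrow> ac_prod r G x w u = u"
  shows "trivial_words r w"
  unfolding trivial_words_def
proof (intro ballI, rule ccontr)
  fix i assume i: "i \<in> {1..r}"
  let ?W = "prod_words w i @ inv_word [(Inl i, True)]"
  define V where "V = foldr push ?W []"
  \<comment> \<open>Ping-pong needs \<open>N\<close> to exceed strictly the length of the tested
    word.\<close>
  define N where "N = Suc (length V)"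
  assume "foldr push ?W [] \<noteq> []"
  then have "V \<noteq> []"
    by (simp add: V_def)
  have x: "x \<in> {1..r} \<rightarrow> carrier G" and gen: "generate G (x ` {1..r}) = carrier G"
    using free by (simp_all add: free_basis_def)
  have W: "?W \<in> lists (letters r)"
    using prod_words_lists[OF w i] inv_word_lists[OF Inl_letter[OF i]] by simp
  have V: "V \<in> lists (letters r)" "reduced V" "length V < N"
    using foldr_push_lists[OF W lists.Nil] reduced_foldr_push[OF reduced_Nil]
    by (simp_all only: V_def N_def)
  \<comment> \<open>Here \<open>r \<ge> 2\<close> enters: the conjugators are words in the first two
    basis letters.\<close>
  have g_lists: "conjugator N j \<in> lists ({1..r} \<times> UNIV)" for j
    using \<open>r \<ge> 2\<close> by (auto simp: conjugator_def)
  define g where "g j = word_val G x (conjugator N j)" for j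
  have g: "g j \<in> carrier G" for j
    using word_val_closed[OF x g_lists] by (simp add: g_def)
  define u where "u = (\<lambda>j \<in> {1..r}. conj_by G (x j) (g j))"
  have u_NGen: "u \<in> NGen r G"
    unfolding u_def using g by (intro conjugates_NGen[OF x gen]) auto
  then have u: "u \<in> tuples r G"
    using NGen_subset by blast
  have b: "case_sum u x \<in> {1..r} <+> {1..r} \<rightarrow> carrier G"
    using u x by (auto simp: Pi_iff)
  have "word_val G (case_sum u x) (prod_words w i) = u i"
    using fixed[OF u_NGen] i unfolding ac_prod_fixes_iff[OF x w u] by blast
  also have "u i = word_val G (case_sum u x) [(Inl i, True)]"
    using u i by (simp add: word_val_single)
  finally have V_one: "word_val G (case_sum u x) V = \<one>"
    unfolding V_def word_val_foldr_push[OF b W]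
    using word_val_eq_iff[OF b prod_words_lists[OF w i] Inl_letter[OF i]] by blast
  have inl_lists: "subst_letter N (Inl j, e) \<in> lists ({1..r} \<times> UNIV)"
    if "j \<in> {1..r}" for j e
    using that g_lists[of j] inv_word_lists[OF g_lists[of j]] by simp
  have inl_val: "letter_val (case_sum u x) (Inl j, e) = word_val G x (subst_letter N (Inl j, e))"
    if j: "j \<in> {1..r}" for j e
  proof -
    have xj: "x j \<in> carrier G" and je: "[(j, e)] \<in> lists ({1..r} \<times> UNIV)"
      using x j by auto
    note gl = g_lists[of j] inv_word_lists[OF g_lists[of j]]
    have "word_val G x (conjugator N j @ [(j, e)] @ inv_word (conjugator N j)) =
        g j \<otimes> (letter_val x (j, e) \<otimes> inv (g j))"
      using gl je xj word_val_inv_word[OF x gl(1)]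
      by (simp add: word_val_append[OF x] word_val_single g_def del: append.simps in_lists_conv_set)
    moreover have "letter_val (case_sum u x) (Inl j, e) = g j \<otimes> (letter_val x (j, e) \<otimes> inv (g j))"
      using j xj g[of j] by (simp add: u_def conj_by_def m_assoc inv_mult_group)
    ultimately show ?thesis
      by simp
  qed
  have "subst_letter N a \<in> lists ({1..r} \<times> UNIV) \<and>
      letter_val (case_sum u x) a = word_val G x (subst_letter N a)" if "a \<in> letters r" for a
    using that
  proof (elim SigmaE PlusE)
    fix l e j assume "a = (l, e)" "l = Inl j" "j \<in> {1..r}"
    then show ?thesis
      using inl_lists[of j e] inl_val[of j e] by blast
  next
    fix l e k assume a: "a = (l, e)" "l = Inr k" "k \<in> {1..r}"
    then have "x k \<in> carrier G"
      using x by blast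
    with a show ?thesis
      by (simp add: word_val_single)
  qed
  then have "word_val G (case_sum u x) V = word_val G x (subst_word N V)
      \<and> subst_word N V \<in> lists ({1..r} \<times> UNIV)"
    by (intro word_val_concat_map[OF x V(1)]) blast+
  with V_one have "word_val G x (subst_word N V) = \<one>"
    "subst_word N V \<in> lists ({1..r} \<times> UNIV)"
    by simp_all
  \<comment> \<open>The substituted word has value one but a nonempty reduced form, against the
    freeness of \<open>x\<close>.\<close>
  moreover have "foldr push (subst_word N V) [] \<noteq> []"
    using V \<open>V \<noteq> []\<close> by (intro subst_word_nontrivial) auto
  ultimately show False
    using free_basis_word_val_eq[OF free, of "subst_word N V" "[]"] by simp
qed

end

section \<open>The common relations of the three groups\<close>

theorem lemma3p2:
  fixes r :: nat
    and G :: "('a, 'b) monoid_scheme"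
    and f y x :: "nat \<Rightarrow> 'a"
  assumes "r \<ge> 2"
    and "group G"
    and "free_basis G ({1..r} <+> {1..r}) (case_sum f y)"
    and "free_basis (F_sub r G f) {1..r} x"
  shows "(\<forall>\<alpha> \<in> carrier (A_r r G f y). \<forall>\<beta>. derived_from r G f y x \<alpha> \<beta> \<longrightarrow>
            (\<exists>u \<in> O_set r G f y. \<alpha> u \<noteq> u) \<longrightarrow>
              (\<exists>u \<in> tuples r (F_sub r G f). \<beta> u \<noteq> u) \<and>
              (\<exists>u \<in> NGen r (F_sub r G f). \<beta> u \<noteq> u)) \<and>
         A_rr r G y \<cong> GAC r (F_sub r G f) \<and>
         A_rr r G y \<cong> AC r (F_sub r G f) \<and>
         GAC r (F_sub r G f) \<cong> AC r (F_sub r G f)"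
proof -
  let ?F = "F_sub r G f"
  let ?W = "lists (ac_symbols r \<times> (UNIV :: bool set))"
  interpret G: group G by fact
  interpret F: group ?F
    unfolding F_sub_def by (rule G.group_subgroup_generated)
  have fy: "case_sum f y \<in> {1..r} <+> {1..r} \<rightarrow> carrier G"
    using assms(3) by (simp add: free_basis_def)
  then have f: "f i \<in> carrier G" if "i \<in> {1..r}" for i
    using that by (auto simp: Pi_iff split: sum.splits)
  have x: "x \<in> {1..r} \<rightarrow> carrier ?F" and gen: "generate ?F (x ` {1..r}) = carrier ?F"
    using assms(4) by (simp_all add: free_basis_def)
  have y: "y \<in> {1..r} \<rightarrow> carrier G"
    using fy by (auto simp: Pi_iff split: sum.splits)
  have F_sub_G: "tuples r ?F \<subseteq> tuples r G"
    using G.carrier_subgroup_generated_subset by (fastforce simp: tuples_def F_sub_def PiE_iff)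
  have f_tuple: "restrict f {1..r} \<in> tuples r ?F"
    using f by (auto simp: tuples_def F_sub_def carrier_subgroup_generated intro!: generate.incl)
  interpret B: group "BijGroup (tuples r G)"
    by (rule group_BijGroup)
  have A_carrier: "carrier (A_rr r G y) = ac_prod r G y ` ?W"
    using B.carrier_subgroup_generated_family[OF G.ac_map_funcset[OF y]]
    by (simp add: A_rr_def ac_prod_def)
  have F_sub_O: "tuples r ?F \<subseteq> O_set r G f y"
  proof
    fix u assume u: "u \<in> tuples r ?F"
    \<comment> \<open>The empty product is the identity, so each starting tuple lies in its own
      orbit.\<close>
    then have "ac_prod r G y [] u = u"
      using F_sub_G by (auto simp: G.ac_prod_Nil)
    moreover have "ac_prod r G y [] \<in> carrier (A_rr r G y)"
      unfolding A_carrier by (rule imageI) simp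
    ultimately have "u \<in> {\<alpha> u |\<alpha>. \<alpha> \<in> carrier (A_rr r G y)}"
      by (metis (mono_tags, lifting) mem_Collect_eq)
    with u show "u \<in> O_set r G f y"
      unfolding O_set_def by blast
  qed
  have O_sub: "O_set r G f y \<subseteq> tuples r G"
  proof
    fix v assume "v \<in> O_set r G f y"
    then obtain u w where "u \<in> tuples r ?F" "w \<in> ?W" "v = ac_prod r G y w u"
      unfolding O_set_def A_carrier by (elim UN_E CollectE exE conjE imageE) simp
    then show "v \<in> tuples r G"
      using F_sub_G G.ac_prod_tuples[OF y] by (simp only: subsetD)
  qed
  \<comment> \<open>Stated for an intermediate \<open>S\<close>, to cover both \<open>O_set\<close>
    and all tuples over \<open>G\<close>. The lower bound guarantees that \<open>S\<close> contains
    the detecting tuple \<open>f\<close>.\<close>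
  have triv_O: "trivial_words r w \<longleftrightarrow> (\<forall>u \<in> S. ac_prod r G y w u = u)"
    if w: "w \<in> ?W" and S: "tuples r ?F \<subseteq> S" "S \<subseteq> tuples r G" for w S
  proof
    assume "trivial_words r w"
    then show "\<forall>u \<in> S. ac_prod r G y w u = u"
      using G.trivial_words_fixes[OF _ y w] S(2) by (simp add: subset_iff)
  next
    assume "\<forall>u \<in> S. ac_prod r G y w u = u"
    then show "trivial_words r w"
      using G.fixes_basis_trivial_words[OF assms(3) w] S(1) f_tuple by (simp add: subset_iff)
  qed
  \<comment> \<open>Same scheme over the subgroup, with \<open>S\<close> either \<open>NGen\<close>
    or all tuples; the detecting tuples of conjugates lie in \<open>NGen\<close>.\<close>
  have triv_F: "trivial_words r w \<longleftrightarrow> (\<forall>u \<in> S. ac_prod r ?F x w u = u)"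
    if w: "w \<in> ?W" and S: "NGen r ?F \<subseteq> S" "S \<subseteq> tuples r ?F" for w S
  proof
    assume "trivial_words r w"
    then show "\<forall>u \<in> S. ac_prod r ?F x w u = u"
      using F.trivial_words_fixes[OF _ x w] S(2) by (simp add: subset_iff)
  next
    assume "\<forall>u \<in> S. ac_prod r ?F x w u = u"
    then show "trivial_words r w"
      using F.fixes_NGen_trivial_words[OF assms(4,1) w] S(1) by (simp add: subset_iff)
  qed
  note triv_A = triv_O[OF _ F_sub_G subset_refl]
    and triv_O = triv_O[OF _ F_sub_O O_sub]
    and triv_N = triv_F[OF _ subset_refl F.NGen_subset]
    and triv_F = triv_F[OF _ F.NGen_subset subset_refl]
  have faithful: "(\<exists>u \<in> tuples r ?F. \<beta> u \<noteq> u) \<and> (\<exists>u \<in> NGen r ?F. \<beta> u \<noteq> u)"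
    if "derived_from r G f y x \<alpha> \<beta>" "\<exists>u \<in> O_set r G f y. \<alpha> u \<noteq> u" for \<alpha> \<beta>
  proof -
    obtain w where w: "w \<in> ?W" "\<alpha> = restrict (ac_prod r G y w) (O_set r G f y)"
      "\<beta> = ac_prod r ?F x w"
      using \<open>derived_from r G f y x \<alpha> \<beta>\<close> unfolding derived_from_def by blast
    \<comment> \<open>The same \<open>w\<close> expresses \<alpha> and \<beta>, and
      \<open>trivial_words\<close> does not see which conjugators are used.\<close>
    have "\<not> trivial_words r w"
      using that(2) w by (auto simp: triv_O)
    then show ?thesis
      using triv_F[OF w(1)] triv_N[OF w(1)] w(3) by blast
  qed
  \<comment> \<open>In each of the three groups the relations among the generators turn out to be
    the \<open>w\<close> with \<open>trivial_words r w\<close>.\<close>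
  have one_G: "word_val (BijGroup (tuples r G)) (ac_map r G y) w = \<one>\<^bsub>BijGroup (tuples r G)\<^esub> \<longleftrightarrow>
      trivial_words r w" if "w \<in> ?W" for w
    using eq_one_BijGroup_iff[OF G.ac_prod_Bij[OF y that]] triv_A[OF that]
    by (simp only: ac_prod_def)
  have one_F: "word_val (BijGroup (tuples r ?F)) (ac_map r ?F x) w =
      \<one>\<^bsub>BijGroup (tuples r ?F)\<^esub> \<longleftrightarrow> trivial_words r w" if "w \<in> ?W" for w
    using eq_one_BijGroup_iff[OF F.ac_prod_Bij[OF x that]] triv_F[OF that]
    by (simp only: ac_prod_def)
  have b_N: "F.ac_map_NGen r x \<in> ac_symbols r \<rightarrow> carrier (BijGroup (NGen r ?F))"
    using F.restrict_ac_map_Bij(1)[OF _ x] by auto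
  have one_N: "word_val (BijGroup (NGen r ?F)) (F.ac_map_NGen r x) w =
      \<one>\<^bsub>BijGroup (NGen r ?F)\<^esub> \<longleftrightarrow> trivial_words r w" if "w \<in> ?W" for w
  proof -
    have "restrict (ac_prod r ?F x w) (NGen r ?F) \<in> Bij (NGen r ?F)"
      using group.word_val_closed[OF group_BijGroup b_N that] F.word_val_ac_map_NGen[OF x that]
      by simp
    from eq_one_BijGroup_iff[OF this] show ?thesis
      unfolding F.word_val_ac_map_NGen[OF x that] triv_N[OF that] by simp
  qed
  note iso = iso_subgroup_generated[OF group_BijGroup group_BijGroup]
  have "A_rr r G y \<cong> GAC r ?F"
    unfolding A_rr_def F.GAC_eq[OF x gen]
    by (rule iso[OF G.ac_map_funcset[OF y] F.ac_map_funcset[OF x]]) (simp only: one_G one_F)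
  moreover have "A_rr r G y \<cong> AC r ?F"
    unfolding A_rr_def F.AC_eq[OF x gen]
    by (rule iso[OF G.ac_map_funcset[OF y] b_N]) (simp only: one_G one_N)
  moreover have "GAC r ?F \<cong> AC r ?F"
    unfolding F.GAC_eq[OF x gen] F.AC_eq[OF x gen]
    by (rule iso[OF F.ac_map_funcset[OF x] b_N]) (simp only: one_F one_N)
  ultimately show ?thesis
    using faithful by blast
qed

end
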